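(* Let $H$ be a bipartite graph with bipartition $A \cup B$, let $r=\max_{b \in B} \deg(b)$ and, for each $1 \leq k \leq r$, let $d_k$ be the number of vertices of degree $k$ in $B$. If $\binom{|A|}{r}\binom{r}{k}$ divides $d_k$ for each $1\leq k\leq r$, then Sidorenko's conjecture holds for $H$, i.e., for every graph $G$, $t_H(G) \geq t_{K_2}(G)^{e(H)}$.
   Context: For graphs $H$ and $G$, a homomorphism from $H$ to $G$ is a map $f:V(H)\to V(G)$ sending edges to edges; $h_H(G)$ is the number of homomorphisms and $t_H(G)=h_H(G)/|V(G)|^{|V(H)|}$ is the homomorphism density. $e(H)$ is the number of edges of $H$. "Sidorenko's conjecture holds for $H$" means $t_H(G)\ge t_{K_2}(G)^{e(H)}$ for every graph $G$ (equivalently, $t_H(W)\ge t_{K_2}(W)^{e(H)}$ for every graphon $W$). *)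

theory Defs
  imports Complex_Main "HOL-Library.FuncSet"
begin

record 'a ugraph =
  verts :: "'a set"
  edges :: "'a set set"

definition simple_graph :: "'a ugraph \<Rightarrow> bool" where
  "simple_graph G \<longleftrightarrow> finite (verts G) \<and> (\<forall>e\<in>edges G. e \<subseteq> verts G \<and> card e = 2)"

definition degree :: "'a ugraph \<Rightarrow> 'a \<Rightarrow> nat" where
  "degree G v = card {e \<in> edges G. v \<in> e}"

definition bipartition :: "'a ugraph \<Rightarrow> 'a set \<Rightarrow> 'a set \<Rightarrow> bool" where
  "bipartition H A B \<longleftrightarrow> A \<union> B = verts H \<and> A \<inter> B = {} \<and>
     (\<forall>e\<in>edges H. \<exists>a\<in>A. \<exists>b\<in>B. e = {a, b})"

text \<open>Homomorphisms are extensional functions, so that each map from \<open>verts H\<close> to \<open>verts G\<close>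
  is counted once. The members of \<open>edges G\<close> have two elements, so \<open>f ` e \<in> edges G\<close> forces the
  ends of \<open>e\<close> to have distinct images.\<close>

definition homs :: "'a ugraph \<Rightarrow> 'b ugraph \<Rightarrow> ('a \<Rightarrow> 'b) set" where
  "homs H G = {f \<in> verts H \<rightarrow>\<^sub>E verts G. \<forall>e\<in>edges H. f ` e \<in> edges G}"

definition hom_count :: "'a ugraph \<Rightarrow> 'b ugraph \<Rightarrow> nat" where
  "hom_count H G = card (homs H G)"

definition hom_density :: "'a ugraph \<Rightarrow> 'b ugraph \<Rightarrow> real" where
  "hom_density H G = real (hom_count H G) / real (card (verts G)) ^ card (verts H)"

definition K2 :: "bool ugraph" where
  "K2 = \<lparr>verts = {False, True}, edges = {{False, True}}\<rparr>"

end

theory Submission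
  imports Defs "HOL-Combinatorics.Permutations"
begin

text \<open>Write \<open>t\<^sub>H(G)\<close> as the mean over \<open>x \<in> V(G)\<^sup>A\<close> of the product of the normalised codegrees of
  \<open>x(N(b))\<close>, \<open>b \<in> B\<close>. Put \<open>m\<^sub>k = d\<^sub>k / ((|A| choose r) (r choose k))\<close> and, for an \<open>r\<close>-set \<open>R \<subseteq> A\<close>, let
  \<open>w\<^sub>R(x)\<close> be the product over \<open>S \<subseteq> R\<close> of \<open>codegree(x(S))\<close> to the power \<open>m\<^sub>|\<^sub>S\<^sub>|\<close>.

  Symmetrisation: under the probability density proportional to \<open>\<Prod>\<^sub>R w\<^sub>R\<close>, which is invariant under
  permutations of \<open>A\<close>, the logarithms of \<open>\<Prod>\<^sub>b codegree(x(N(b)))\<close> and of \<open>\<Prod>\<^sub>R w\<^sub>R\<close> have the same mean, so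
  Jensen's inequality gives that \<open>t\<^sub>H(G)\<close> is at least the mean of \<open>\<Prod>\<^sub>R w\<^sub>R\<close>.

  Percolation: \<open>w\<^sub>R\<close> is a Gram kernel in any two of its coordinates, so reflecting a family of \<open>r\<close>-sets
  in a transposition, in either direction, does not decrease the mean of the product over the family
  on average. With \<open>w\<^sub>R\<close> scaled to mean 1, a family with the largest mean stays optimal under reflections, and reflections
  spread it to all \<open>r\<close>-sets. Hence the mean of \<open>\<Prod>\<^sub>R w\<^sub>R\<close> is at least the product of the means.

  A single \<open>w\<^sub>R\<close> has \<open>m\<^sub>r \<ge> 1\<close>, that is, a vertex joined to all of \<open>R\<close>. Its mean is bounded by the
  argument of Conlon, Fox and Sudakov: compare with a random star whose centre is chosen
  proportionally to its degree and whose leaves are independent neighbours of the centre.\<close>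

subsection \<open>Sums over extensional functions and Gram kernels\<close>

lemma sum_PiE_insert:
  assumes "i \<notin> A"
  shows "(\<Sum>x\<in>insert i A \<rightarrow>\<^sub>E V. \<Phi> x) = (\<Sum>z\<in>A \<rightarrow>\<^sub>E V. \<Sum>u\<in>V. \<Phi> (z(i := u)))"
proof -
  have "(\<Sum>x\<in>insert i A \<rightarrow>\<^sub>E V. \<Phi> x) = (\<Sum>(u, z)\<in>V \<times> (A \<rightarrow>\<^sub>E V). \<Phi> (z(i := u)))"
    unfolding PiE_insert_eq
    by (subst sum.reindex[OF inj_combinator[OF assms]]) (simp add: case_prod_unfold)
  also have "\<dots> = (\<Sum>z\<in>A \<rightarrow>\<^sub>E V. \<Sum>u\<in>V. \<Phi> (z(i := u)))"
    by (simp add: sum.cartesian_product[symmetric] sum.swap[of _ V])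
  finally show ?thesis .
qed

text \<open>Once the coordinates in \<open>A\<close> are fixed, every coordinate in \<open>B\<close>
  occurs in a factor of its own, so the sum over them factorises. The update hypotheses say that
  \<psi> and \<phi> see only the coordinates in \<open>A\<close>. The induction leaves \<psi>
  arbitrary because \<psi> absorbs the summed factor of each coordinate that is removed.\<close>

lemma sum_PiE_Un:
  fixes \<psi> :: "('a \<Rightarrow> 'b) \<Rightarrow> 'c :: comm_semiring_1"
  assumes "finite B" "A \<inter> B = {}"
    and "\<And>f c w. c \<notin> A \<Longrightarrow> \<psi> (f(c := w)) = \<psi> f"
    and "\<And>b f c w v. c \<notin> A \<Longrightarrow> \<phi> b (f(c := w)) v = \<phi> b f v"
  shows "(\<Sum>f\<in>A \<union> B \<rightarrow>\<^sub>E V. \<psi> f * (\<Prod>b\<in>B. \<phi> b f (f b))) =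
         (\<Sum>x\<in>A \<rightarrow>\<^sub>E V. \<psi> x * (\<Prod>b\<in>B. \<Sum>v\<in>V. \<phi> b x v))"
proof -
  have \<phi>_upd: "\<phi> b (f(c := w)) = \<phi> b f" if "c \<notin> A" for b f c w
    using assms(4)[OF that] by blast
  show ?thesis using assms(1-3)
  proof (induction B arbitrary: \<psi>)
    case (insert c B)
    then have c: "c \<notin> A \<union> B" "c \<notin> A" "c \<notin> B" by auto
    have "(\<Sum>f\<in>A \<union> insert c B \<rightarrow>\<^sub>E V. \<psi> f * (\<Prod>b\<in>insert c B. \<phi> b f (f b))) =
          (\<Sum>f\<in>A \<union> B \<rightarrow>\<^sub>E V. \<Sum>u\<in>V. \<psi> f * (\<phi> c f u * (\<Prod>b\<in>B. \<phi> b f ((f(c := u)) b))))"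
      using c insert.hyps by (simp add: sum_PiE_insert insert.prems assms(4))
    also have "\<dots> = (\<Sum>f\<in>A \<union> B \<rightarrow>\<^sub>E V. (\<psi> f * (\<Sum>u\<in>V. \<phi> c f u)) * (\<Prod>b\<in>B. \<phi> b f (f b)))"
    proof (intro sum.cong refl)
      fix f
      have "(\<Prod>b\<in>B. \<phi> b f ((f(c := u)) b)) = (\<Prod>b\<in>B. \<phi> b f (f b))" for u
        using c by (intro prod.cong) auto
      then show "(\<Sum>u\<in>V. \<psi> f * (\<phi> c f u * (\<Prod>b\<in>B. \<phi> b f ((f(c := u)) b)))) =
          (\<psi> f * (\<Sum>u\<in>V. \<phi> c f u)) * (\<Prod>b\<in>B. \<phi> b f (f b))"
        by (simp add: sum_distrib_left sum_distrib_right mult_ac)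
    qed
    also have "\<dots> = (\<Sum>x\<in>A \<rightarrow>\<^sub>E V. (\<psi> x * (\<Sum>u\<in>V. \<phi> c x u)) * (\<Prod>b\<in>B. \<Sum>v\<in>V. \<phi> b x v))"
    proof (rule insert.IH)
      show "A \<inter> B = {}" using insert.prems(1) by blast
      show "\<psi> (f(d := w)) * (\<Sum>u\<in>V. \<phi> c (f(d := w)) u) = \<psi> f * (\<Sum>u\<in>V. \<phi> c f u)"
        if "d \<notin> A" for d f w
        unfolding insert.prems(2)[OF that] \<phi>_upd[OF that] ..
    qed
    finally show ?case using insert.hyps by (simp add: mult_ac)
  qed simp
qed

text \<open>Positive semidefiniteness in the form of an explicit finite sum of rank-one kernels.
  Closure under pointwise products (Schur's product theorem) then reduces to multiplying the
  summands pairwise.\<close>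

definition gram :: "('b \<Rightarrow> 'b \<Rightarrow> real) \<Rightarrow> bool" where
  "gram M \<longleftrightarrow> (\<exists>ks. \<forall>u v. M u v = (\<Sum>k\<leftarrow>ks. k u * k v))"

lemma gram_rank_one: "gram (\<lambda>u v. f u * f v)"
  unfolding gram_def by (rule exI[of _ "[f]"]) simp

lemma gram_const: "0 \<le> c \<Longrightarrow> gram (\<lambda>u v. c)"
  using gram_rank_one[of "\<lambda>_. sqrt c"] by simp

lemma gram_add:
  assumes "gram M" "gram M'"
  shows "gram (\<lambda>u v. M u v + M' u v)"
proof -
  obtain ks where "\<forall>u v. M u v = (\<Sum>k\<leftarrow>ks. k u * k v)"
    using assms(1) unfolding gram_def by blast
  moreover obtain ls where "\<forall>u v. M' u v = (\<Sum>k\<leftarrow>ls. k u * k v)"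
    using assms(2) unfolding gram_def by blast
  ultimately show ?thesis unfolding gram_def by (intro exI[of _ "ks @ ls"]) simp
qed

lemma gram_sum: "(\<And>a. a \<in> A \<Longrightarrow> gram (M a)) \<Longrightarrow> gram (\<lambda>u v. \<Sum>a\<in>A. M a u v)"
  by (induction A rule: infinite_finite_induct) (auto intro: gram_add gram_const)

lemma gram_mult:
  assumes "gram M" "gram M'"
  shows "gram (\<lambda>u v. M u v * M' u v)"
proof -
  obtain ks where "\<forall>u v. M u v = (\<Sum>k\<leftarrow>ks. k u * k v)"
    using assms(1) unfolding gram_def by blast
  then have M: "M u v = (\<Sum>k\<leftarrow>ks. k u * k v)" for u v by blast
  obtain ls where "\<forall>u v. M' u v = (\<Sum>l\<leftarrow>ls. l u * l v)"
    using assms(2) unfolding gram_def by blast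
  then have M': "M' u v = (\<Sum>l\<leftarrow>ls. l u * l v)" for u v by blast
  have row: "(\<Sum>h\<leftarrow>map (\<lambda>l w. k w * l w) ls. h u * h v) = k u * k v * M' u v" for k u v
    unfolding M' by (induction ls) (simp_all add: algebra_simps)
  have "M u v * M' u v = (\<Sum>h\<leftarrow>concat (map (\<lambda>k. map (\<lambda>l w. k w * l w) ls) ks). h u * h v)" for u v
    unfolding M by (induction ks) (simp_all only: list.map concat.simps map_append sum_list_append row
      sum_list.Nil sum_list.Cons distrib_right mult_zero_left)
  then show ?thesis unfolding gram_def by blast
qed

lemma gram_prod: "(\<And>a. a \<in> A \<Longrightarrow> gram (M a)) \<Longrightarrow> gram (\<lambda>u v. \<Prod>a\<in>A. M a u v)"
  by (induction A rule: infinite_finite_induct) (auto intro: gram_mult gram_const)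

lemma gram_power: "gram M \<Longrightarrow> gram (\<lambda>u v. M u v ^ n)"
  by (induction n) (auto intro: gram_mult gram_const)

lemma gram_sym: "gram M \<Longrightarrow> M u v = M v u"
  by (auto simp: gram_def mult_ac)

lemma gram_quadratic_form_nonneg:
  assumes "gram M"
  shows "0 \<le> (\<Sum>u\<in>V. \<Sum>v\<in>V. q u * q v * M u v)"
proof -
  obtain ks where "\<forall>u v. M u v = (\<Sum>k\<leftarrow>ks. k u * k v)"
    using assms unfolding gram_def by blast
  then have M: "M = (\<lambda>u v. \<Sum>k\<leftarrow>ks. k u * k v)" by blast
  show ?thesis unfolding M
  proof (induction ks)
    case (Cons k ks)
    have "(\<Sum>u\<in>V. \<Sum>v\<in>V. q u * q v * (\<Sum>k\<leftarrow>k # ks. k u * k v)) =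
      (\<Sum>u\<in>V. q u * k u)\<^sup>2 + (\<Sum>u\<in>V. \<Sum>v\<in>V. q u * q v * (\<Sum>k\<leftarrow>ks. k u * k v))"
      by (simp add: power2_eq_square sum_product sum.distrib distrib_left mult_ac)
    then show ?case using Cons by simp
  qed simp
qed

text \<open>Expand the nonnegative quadratic form at \<open>f - h\<close>; symmetry of the kernel
  merges the two mixed terms.\<close>

lemma gram_bilinear_form_le:
  assumes "gram M"
  shows "2 * (\<Sum>u\<in>V. \<Sum>v\<in>V. f u * h v * M u v) \<le>
     (\<Sum>u\<in>V. \<Sum>v\<in>V. f u * f v * M u v) + (\<Sum>u\<in>V. \<Sum>v\<in>V. h u * h v * M u v)"
proof -
  have "(\<Sum>u\<in>V. \<Sum>v\<in>V. h u * f v * M u v) = (\<Sum>u\<in>V. \<Sum>v\<in>V. f u * h v * M u v)"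
    by (subst sum.swap) (simp add: gram_sym[OF assms] mult_ac)
  moreover have "(\<Sum>u\<in>V. \<Sum>v\<in>V. (f u - h u) * (f v - h v) * M u v) =
     (\<Sum>u\<in>V. \<Sum>v\<in>V. f u * f v * M u v) - (\<Sum>u\<in>V. \<Sum>v\<in>V. f u * h v * M u v)
     - (\<Sum>u\<in>V. \<Sum>v\<in>V. h u * f v * M u v) + (\<Sum>u\<in>V. \<Sum>v\<in>V. h u * h v * M u v)"
    by (simp add: sum.distrib[symmetric] sum_subtractf[symmetric] algebra_simps)
  ultimately show ?thesis
    using gram_quadratic_form_nonneg[OF assms, of "\<lambda>u. f u - h u" V] by simp
qed

subsection \<open>Percolation by reflections\<close>

lemma sum_PiE_two_points:
  assumes "i \<in> A" "j \<in> A" "i \<noteq> j"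
  shows "(\<Sum>x\<in>A \<rightarrow>\<^sub>E V. \<Phi> x) = (\<Sum>z\<in>A - {i, j} \<rightarrow>\<^sub>E V. \<Sum>u\<in>V. \<Sum>v\<in>V. \<Phi> (z(i := u, j := v)))"
proof -
  have "A = insert j (insert i (A - {i, j}))" using assms by auto
  then have "(\<Sum>x\<in>A \<rightarrow>\<^sub>E V. \<Phi> x) = (\<Sum>x\<in>insert j (insert i (A - {i, j})) \<rightarrow>\<^sub>E V. \<Phi> x)" by simp
  also have "\<dots> = (\<Sum>z\<in>A - {i, j} \<rightarrow>\<^sub>E V. \<Sum>u\<in>V. \<Sum>v\<in>V. \<Phi> (z(i := u, j := v)))"
    using assms by (subst sum_PiE_insert) (auto simp: sum_PiE_insert)
  finally show ?thesis .
qed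

text \<open>A fold along the transposition: sets with both or neither of \<open>i\<close>,
  \<open>j\<close> are their own mirror images, and the half of the family on the side of
  \<open>j\<close> is overwritten by the mirror image of the half on the side of
  \<open>i\<close>.\<close>

definition reflect :: "'a \<Rightarrow> 'a \<Rightarrow> 'a set set \<Rightarrow> 'a set set" where
  "reflect i j \<F> = {R \<in> \<F>. i \<in> R \<or> j \<notin> R} \<union> (`) (transpose i j) ` {R \<in> \<F>. i \<in> R \<and> j \<notin> R}"

text \<open>The properties of the codegree weights on which percolation rests. They survive
  multiplication by a positive constant, so the weights can be normalised later.
  \<open>W_upd\<close> expresses that \<open>W R\<close> depends only on the coordinates in
  \<open>R\<close>.\<close>

locale exchangeable_weight =
  fixes A :: "'a set" and V :: "'b set" and W :: "'a set \<Rightarrow> ('a \<Rightarrow> 'b) \<Rightarrow> real"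
  assumes finite_A: "finite A" and finite_V: "finite V"
    and W_nonneg: "0 \<le> W R x"
    and W_upd: "c \<notin> R \<Longrightarrow> W R (x(c := u)) = W R x"
    and W_transpose: "W (transpose i j ` R) x = W R (x \<circ> transpose i j)"
    and W_gram: "i \<in> R \<Longrightarrow> j \<in> R \<Longrightarrow> i \<noteq> j \<Longrightarrow> gram (\<lambda>u v. W R (x(i := u, j := v)))"
begin

definition total :: "'a set set \<Rightarrow> real" where
  "total \<F> = (\<Sum>x\<in>A \<rightarrow>\<^sub>E V. \<Prod>R\<in>\<F>. W R x)"

lemma W_transpose_upd:
  assumes "i \<in> R" "j \<notin> R"
  shows "W (transpose i j ` R) (z(j := v)) = W R (z(i := v))"
proof -
  have "z(j := v) \<circ> transpose i j = z(i := v, j := z i)"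
    using assms by (auto simp: fun_eq_iff transpose_def)
  then show ?thesis using assms by (simp add: W_transpose W_upd)
qed

text \<open>Fix all coordinates except \<open>i\<close> and \<open>j\<close>. Sets containing only
  \<open>i\<close> contribute a function \<open>f\<close> of one value, those containing only
  \<open>j\<close> a function \<open>h\<close> of the other, and the remaining sets a Gram kernel
  \<open>M\<close>. The three totals are sums of the bilinear form of \<open>M\<close> at the pairs
  (f, h), (f, f) and (h, h), so \<open>gram_bilinear_form_le\<close> applies.\<close>

lemma total_reflect_le:
  assumes ij: "i \<in> A" "j \<in> A" "i \<noteq> j" and fin: "finite \<F>"
  shows "2 * total \<F> \<le> total (reflect i j \<F>) + total (reflect j i \<F>)"
proof -
  let ?\<tau> = "transpose i j"
  define \<D> where "\<D> = {R \<in> \<F>. i \<in> R \<longleftrightarrow> j \<in> R}"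
  define \<G> where "\<G> = {R \<in> \<F>. i \<in> R \<and> j \<notin> R}"
  define \<H> where "\<H> = {R \<in> \<F>. j \<in> R \<and> i \<notin> R}"
  define M where "M z u v = (\<Prod>R\<in>\<D>. W R (z(i := u, j := v)))" for z u v
  define f where "f z u = (\<Prod>R\<in>\<G>. W R (z(i := u)))" for z u
  define h where "h z v = (\<Prod>R\<in>\<H>. W R (z(j := v)))" for z v
  have fins: "finite \<D>" "finite \<G>" "finite \<H>" using fin by (auto simp: \<D>_def \<G>_def \<H>_def)
  have split: "total (\<D> \<union> \<P> \<union> \<Q>) = (\<Sum>z\<in>A - {i, j} \<rightarrow>\<^sub>E V. \<Sum>u\<in>V. \<Sum>v\<in>V.
      (\<Prod>R\<in>\<P>. W R (z(i := u))) * (\<Prod>R\<in>\<Q>. W R (z(j := v))) * M z u v)"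
    if "finite \<P>" "finite \<Q>" and P: "\<forall>R\<in>\<P>. i \<in> R \<and> j \<notin> R"
      and Q: "\<forall>R\<in>\<Q>. j \<in> R \<and> i \<notin> R" for \<P> \<Q>
  proof -
    have "\<D> \<inter> \<P> = {}" "(\<D> \<union> \<P>) \<inter> \<Q> = {}" using P Q by (auto simp: \<D>_def)
    then have "(\<Prod>R\<in>\<D> \<union> \<P> \<union> \<Q>. W R x) = (\<Prod>R\<in>\<D>. W R x) * (\<Prod>R\<in>\<P>. W R x) * (\<Prod>R\<in>\<Q>. W R x)" for x
      using fins that(1,2) by (simp add: prod.union_disjoint)
    moreover have "(\<Prod>R\<in>\<P>. W R (z(i := u, j := v))) = (\<Prod>R\<in>\<P>. W R (z(i := u)))" for z u v
      using P by (intro prod.cong refl W_upd) auto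
    moreover have "(\<Prod>R\<in>\<Q>. W R (z(i := u, j := v))) = (\<Prod>R\<in>\<Q>. W R (z(j := v)))" for z u v
      using Q by (intro prod.cong refl) (simp add: fun_upd_twist[OF ij(3)] W_upd)
    ultimately show ?thesis
      unfolding total_def sum_PiE_two_points[OF ij] M_def by (simp add: mult_ac)
  qed
  have image_inj: "inj_on ((`) ?\<tau>) X" for X by (metis inj_image_eq_iff inj_onI inj_transpose)
  have swap_i: "(\<Prod>R\<in>(`) ?\<tau> ` \<G>. W R (z(j := v))) = f z v" for z v
    unfolding f_def by (subst prod.reindex[OF image_inj]) (simp add: \<G>_def W_transpose_upd)
  have swap_j: "(\<Prod>R\<in>(`) ?\<tau> ` \<H>. W R (z(i := u))) = h z u" for z u
    unfolding h_def
    by (subst prod.reindex[OF image_inj]) (simp add: \<H>_def W_transpose_upd transpose_commute[of i j])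
  have mem: "i \<in> ?\<tau> ` R \<longleftrightarrow> j \<in> R" "j \<in> ?\<tau> ` R \<longleftrightarrow> i \<in> R" for R
    by (auto simp: image_iff transpose_def)
  have G: "\<forall>R\<in>\<G>. i \<in> R \<and> j \<notin> R" by (simp add: \<G>_def)
  have H: "\<forall>R\<in>\<H>. j \<in> R \<and> i \<notin> R" by (simp add: \<H>_def)
  have \<tau>G: "\<forall>R\<in>(`) ?\<tau> ` \<G>. j \<in> R \<and> i \<notin> R"
    unfolding ball_simps(9) mem using G by blast
  have \<tau>H: "\<forall>R\<in>(`) ?\<tau> ` \<H>. i \<in> R \<and> j \<notin> R"
    unfolding ball_simps(9) mem using H by blast
  have "\<F> = \<D> \<union> \<G> \<union> \<H>" by (auto simp: \<D>_def \<G>_def \<H>_def)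
  then have 1: "total \<F> = (\<Sum>z\<in>A - {i, j} \<rightarrow>\<^sub>E V. \<Sum>u\<in>V. \<Sum>v\<in>V. f z u * h z v * M z u v)"
    using split[OF fins(2,3) G H, folded f_def h_def] by (simp only:)
  have "reflect i j \<F> = \<D> \<union> \<G> \<union> (`) ?\<tau> ` \<G>"
    unfolding \<D>_def \<G>_def reflect_def by blast
  then have 2: "total (reflect i j \<F>) =
      (\<Sum>z\<in>A - {i, j} \<rightarrow>\<^sub>E V. \<Sum>u\<in>V. \<Sum>v\<in>V. f z u * f z v * M z u v)"
    using split[OF fins(2) finite_imageI[OF fins(2)] G \<tau>G, unfolded swap_i, folded f_def]
    by (simp only:)
  have "reflect j i \<F> = \<D> \<union> (`) ?\<tau> ` \<H> \<union> \<H>"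
    unfolding \<D>_def \<H>_def reflect_def transpose_commute[of j i] by blast
  then have 3: "total (reflect j i \<F>) =
      (\<Sum>z\<in>A - {i, j} \<rightarrow>\<^sub>E V. \<Sum>u\<in>V. \<Sum>v\<in>V. h z u * h z v * M z u v)"
    using split[OF finite_imageI[OF fins(3)] fins(3) \<tau>H H, unfolded swap_j, folded h_def]
    by (simp only:)
  \<comment> \<open>A set containing neither point contributes a nonnegative constant, which is a
    Gram kernel as well.\<close>
  have M_gram: "gram (M z)" for z
    unfolding M_def
  proof (rule gram_prod)
    fix R assume "R \<in> \<D>"
    then consider "i \<in> R" "j \<in> R" | "i \<notin> R" "j \<notin> R" by (auto simp: \<D>_def)
    then show "gram (\<lambda>u v. W R (z(i := u, j := v)))"
      by cases (simp_all add: W_gram ij W_nonneg gram_const W_upd)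
  qed
  show ?thesis
    unfolding 1 2 3
    by (subst sum_distrib_left, subst sum.distrib[symmetric])
      (intro sum_mono gram_bilinear_form_le M_gram)
qed

text \<open>Folds of a family with the largest total again have the largest total. Folding such a
  family towards one of its members \<open>R0\<close> collects all \<open>r\<close>-sets, by
  induction on the distance \<open>card (R0 - Q)\<close>.\<close>

lemma total_percolates:
  fixes r :: nat
  defines "\<C> \<equiv> {R. R \<subseteq> A \<and> card R = r}"
  assumes R1: "R1 \<in> \<C>" and one: "total {} \<le> total {R1}"
  shows "total {R1} \<le> total \<C>"
proof -
  have fin: "finite \<C>" using finite_A by (simp add: \<C>_def)
  define m where "m = Max (total ` Pow \<C>)"
  have le_m: "total \<F> \<le> m" if "\<F> \<subseteq> \<C>" for \<F>
    using that fin by (auto simp: m_def)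
  have "m \<in> total ` Pow \<C>" unfolding m_def using fin by (intro Max_in) auto
  then obtain \<F>0 where \<F>0: "\<F>0 \<subseteq> \<C>" "total \<F>0 = m" by auto
  \<comment> \<open>Folding cannot enlarge the empty family. If that one is optimal,
    \<open>one\<close> makes \<open>{R1}\<close> optimal too.\<close>
  have "\<exists>\<F>\<subseteq>\<C>. \<F> \<noteq> {} \<and> total \<F> = m"
  proof (cases "\<F>0 = {}")
    case True
    then have "total {R1} = m" using \<F>0 one le_m[of "{R1}"] R1 by simp
    then show ?thesis using R1 by (intro exI[of _ "{R1}"]) simp
  qed (use \<F>0 in blast)
  then obtain \<F>1 R0 where \<F>1: "\<F>1 \<subseteq> \<C>" "total \<F>1 = m" "R0 \<in> \<F>1" by blast
  then have R0: "R0 \<in> \<C>" by blast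
  define maximal where "maximal \<F> \<longleftrightarrow> \<F> \<subseteq> \<C> \<and> R0 \<in> \<F> \<and> total \<F> = m" for \<F>
  have reflect_sub: "reflect i j \<F> \<subseteq> \<C>" if "\<F> \<subseteq> \<C>" "i \<in> A" "j \<in> A" for i j \<F>
  proof -
    have "transpose i j ` R \<in> \<C>" if "R \<in> \<C>" for R
    proof -
      have "transpose i j ` R \<subseteq> A"
        using that \<open>i \<in> A\<close> \<open>j \<in> A\<close> by (auto simp: \<C>_def transpose_def)
      then show ?thesis using that by (simp add: \<C>_def card_image)
    qed
    then show ?thesis using that by (auto simp: reflect_def)
  qed
  \<comment> \<open>Neither fold exceeds \<open>m\<close>, while the two add up to at least
    \<open>2 * m\<close>, so both attain it. \<open>R0\<close> survives because it contains
    \<open>i\<close>.\<close>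
  have step: "maximal (reflect i j \<F>)"
    if "maximal \<F>" "i \<in> R0" "j \<notin> R0" "j \<in> A" for i j \<F>
  proof -
    have sub: "\<F> \<subseteq> \<C>" "R0 \<in> \<F>" and m: "total \<F> = m" using that by (auto simp: maximal_def)
    have ij: "i \<in> A" "j \<in> A" "i \<noteq> j" using that R0 by (auto simp: \<C>_def)
    have "2 * m \<le> total (reflect i j \<F>) + total (reflect j i \<F>)"
      using total_reflect_le[OF ij finite_subset[OF sub(1) fin]] m by simp
    moreover have "total (reflect i j \<F>) \<le> m" "total (reflect j i \<F>) \<le> m"
      using sub ij by (auto intro!: le_m dest: reflect_sub)
    ultimately show ?thesis using sub that reflect_sub[OF sub(1) ij(1,2)]
      by (auto simp: maximal_def reflect_def)
  qed
  have start: "\<exists>\<F>. maximal \<F>"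
    using \<F>1 by (auto simp: maximal_def)
  \<comment> \<open>A reflection towards \<open>R0\<close> keeps every set at distance at most \<open>d + 1\<close> from \<open>R0\<close>: the sets
    that it could lose are decided by their mirror images, which are at distance at most \<open>d\<close>.\<close>
  have "\<exists>\<F>. maximal \<F> \<and> (\<forall>Q\<in>\<C>. card (R0 - Q) \<le> d \<longrightarrow> Q \<in> \<F>)" for d
  proof (induction d)
    case 0
    have "Q = R0" if "Q \<in> \<C>" "card (R0 - Q) \<le> 0" for Q
    proof -
      have "finite R0" "finite Q" "card Q = card R0" using that R0 finite_A
        by (auto simp: \<C>_def intro: finite_subset)
      then show ?thesis using that by (metis Diff_eq_empty_iff card_0_eq card_subset_eq finite_Diff le_zero_eq)
    qed
    then show ?case using start by (metis maximal_def)
  next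
    case (Suc d)
    \<comment> \<open>Among the optimal families with all sets at distance at most \<open>d\<close>,
      take one with the most sets at distance at most \<open>Suc d\<close>. If a set
      \<open>Q\<close> at that distance were missing, a fold would increase this number.\<close>
    define near where "near \<F> = {Q \<in> \<F>. card (R0 - Q) \<le> Suc d}" for \<F> :: "'a set set"
    define good where "good \<F> \<longleftrightarrow> maximal \<F> \<and> (\<forall>Q\<in>\<C>. card (R0 - Q) \<le> d \<longrightarrow> Q \<in> \<F>)" for \<F>
    have "card (near \<F>) < Suc (card \<C>)" if "good \<F>" for \<F>
      using that card_mono[OF fin, of "near \<F>"] by (auto simp: good_def maximal_def near_def less_Suc_eq_le)
    then obtain \<F> where \<F>: "good \<F>" and largest: "\<And>\<F>'. good \<F>' \<Longrightarrow> card (near \<F>') \<le> card (near \<F>)"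
      using Suc.IH ex_has_greatest_nat[of good _ "\<lambda>\<F>. card (near \<F>)" "Suc (card \<C>)"]
      unfolding good_def[symmetric] by blast
    have "Q \<in> \<F>" if Q: "Q \<in> \<C>" "card (R0 - Q) \<le> Suc d" for Q
    proof (rule ccontr)
      assume "Q \<notin> \<F>"
      have fR: "finite R0" "finite Q" "card Q = card R0" using Q R0 finite_A
        by (auto simp: \<C>_def intro: finite_subset)
      have "Q \<noteq> R0" using \<open>Q \<notin> \<F>\<close> \<F> by (auto simp: good_def maximal_def)
      then obtain i j where ij: "i \<in> R0" "i \<notin> Q" "j \<in> Q" "j \<notin> R0"
        using fR by (metis card_subset_eq subsetI)
      have jA: "j \<in> A" using ij Q by (auto simp: \<C>_def)
      have closer: "card (R0 - transpose i j ` R) < card (R0 - R)" if "i \<notin> R" "j \<in> R" for R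
      proof (rule psubset_card_mono)
        show "finite (R0 - R)" using fR by simp
        have "k \<in> transpose i j ` R" if "k \<in> R" "k \<noteq> j" for k
          using that \<open>i \<notin> R\<close> by (auto simp: image_iff transpose_def intro!: bexI[of _ k])
        moreover have "i \<in> transpose i j ` R" using that by (auto simp: image_iff transpose_def)
        ultimately show "R0 - transpose i j ` R \<subset> R0 - R" using ij that by blast
      qed
      let ?\<F>' = "reflect i j \<F>"
      have max': "maximal ?\<F>'" using step \<F> ij jA by (auto simp: good_def)
      \<comment> \<open>The alternative \<open>i \<notin> R \<and> j \<in> R\<close> stands in for
        membership in \<F>, so that the fact also applies to the missing set
        \<open>Q\<close>.\<close>
      have keep: "R \<in> ?\<F>'" if R: "R \<in> \<C>" "card (R0 - R) \<le> Suc d" "R \<in> \<F> \<or> i \<notin> R \<and> j \<in> R" for R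
      proof (cases "i \<notin> R \<and> j \<in> R")
        case True
        have "transpose i j ` R \<subseteq> A"
          using R(1) jA ij(1) R0 by (auto simp: \<C>_def transpose_def)
        moreover have "card (transpose i j ` R) = r" using R(1) by (simp add: \<C>_def card_image)
        ultimately have "transpose i j ` R \<in> \<F>"
          using \<F> closer[of R] True R(2) by (auto simp: good_def \<C>_def)
        moreover have "i \<in> transpose i j ` R" "j \<notin> transpose i j ` R"
          using True by (auto simp: image_iff transpose_def)
        moreover have "R = transpose i j ` transpose i j ` R" by (simp add: image_comp)
        ultimately show ?thesis unfolding reflect_def by blast
      qed (use R in \<open>auto simp: reflect_def\<close>)
      have \<F>sub: "\<F> \<subseteq> \<C>" using \<F> by (simp add: good_def maximal_def)
      have "good ?\<F>'" using max' keep \<F> by (auto simp: good_def)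
      moreover have "insert Q (near \<F>) \<subseteq> near ?\<F>'"
        using keep Q ij \<F>sub by (auto simp: near_def)
      moreover have "finite (near ?\<F>')"
        using max' fin by (auto simp: near_def maximal_def intro: finite_subset)
      ultimately have "card (insert Q (near \<F>)) \<le> card (near \<F>)"
        by (meson card_mono largest le_trans)
      moreover have "finite (near \<F>)" "Q \<notin> near \<F>"
        using \<F>sub fin \<open>Q \<notin> \<F>\<close> by (auto simp: near_def intro: finite_subset)
      ultimately show False by simp
    qed
    then show ?case using \<F> by (auto simp: good_def)
  qed
  \<comment> \<open>No \<open>r\<close>-set is at distance more than \<open>r\<close> from
    \<open>R0\<close>, so now nothing is missing.\<close>
  from this[of r] obtain \<F> where \<F>: "maximal \<F>" "\<And>Q. Q \<in> \<C> \<Longrightarrow> card (R0 - Q) \<le> r \<Longrightarrow> Q \<in> \<F>" by blast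
  have "finite R0" "card R0 = r" using R0 finite_A by (auto simp: \<C>_def intro: finite_subset)
  then have "card (R0 - Q) \<le> r" for Q
    using card_mono[of R0 "R0 - Q"] by simp
  then have "\<F> = \<C>" using \<F> by (auto simp: maximal_def)
  then show ?thesis using \<F>(1) le_m[of "{R1}"] R1 by (simp add: maximal_def)
qed
end

subsection \<open>Codegree weights\<close>

context exchangeable_weight
begin

text \<open>Divide all weights by the mean \<open>a\<close> of \<open>W R0\<close>. Then
  \<open>{}\<close> and \<open>{R0}\<close> have equal totals, as \<open>total_percolates\<close>
  requires, and the total of \<C> is divided by \<open>a ^ card \<C>\<close>. If
  \<open>a = 0\<close>, the left side vanishes because \<C> is nonempty.\<close>

lemma mean_power_le:
  fixes r :: nat
  defines "\<C> \<equiv> {R. R \<subseteq> A \<and> card R = r}"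
  assumes R0: "R0 \<in> \<C>" and V: "V \<noteq> {}"
  shows "((\<Sum>x\<in>A \<rightarrow>\<^sub>E V. W R0 x) / card V ^ card A) ^ card \<C> \<le>
    (\<Sum>x\<in>A \<rightarrow>\<^sub>E V. \<Prod>R\<in>\<C>. W R x) / card V ^ card A"
proof -
  have fin: "finite \<C>" using finite_A by (simp add: \<C>_def)
  define c where "c = real (card V) ^ card A"
  have c: "c > 0" using V finite_V by (simp add: c_def card_gt_0_iff)
  define a where "a = (\<Sum>x\<in>A \<rightarrow>\<^sub>E V. W R0 x) / c"
  have "0 \<le> a" using c by (auto simp: a_def W_nonneg intro!: sum_nonneg divide_nonneg_pos)
  then consider "a = 0" | "a > 0" by fastforce
  then have "a ^ card \<C> \<le> (\<Sum>x\<in>A \<rightarrow>\<^sub>E V. \<Prod>R\<in>\<C>. W R x) / c"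
  proof cases
    case 1
    have "card \<C> > 0" using R0 fin by (auto simp: card_gt_0_iff)
    then have "a ^ card \<C> = 0" using 1 by simp
    moreover have "0 \<le> (\<Sum>x\<in>A \<rightarrow>\<^sub>E V. \<Prod>R\<in>\<C>. W R x) / c"
      using c by (intro divide_nonneg_pos sum_nonneg prod_nonneg) (auto simp: W_nonneg)
    ultimately show ?thesis by (simp only:)
  next
    case 2
    interpret scaled: exchangeable_weight A V "\<lambda>R x. inverse a * W R x"
      using 2 by unfold_locales
        (simp_all add: finite_A finite_V W_nonneg W_upd W_transpose W_gram gram_mult gram_const)
    have "scaled.total {} = c"
      using finite_A by (simp add: scaled.total_def c_def card_funcsetE)
    moreover have "scaled.total {R0} = c"
    proof -
      have "scaled.total {R0} = inverse a * (\<Sum>x\<in>A \<rightarrow>\<^sub>E V. W R0 x)"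
        by (simp add: scaled.total_def sum_distrib_left)
      also have "(\<Sum>x\<in>A \<rightarrow>\<^sub>E V. W R0 x) = a * c" using c by (simp add: a_def)
      finally show ?thesis using 2 by simp
    qed
    ultimately have "c \<le> scaled.total \<C>"
      using scaled.total_percolates[of R0 r] R0 by (simp add: \<C>_def)
    also have "scaled.total \<C> = (\<Sum>x\<in>A \<rightarrow>\<^sub>E V. \<Prod>R\<in>\<C>. W R x) / a ^ card \<C>"
      by (simp add: scaled.total_def prod.distrib sum_distrib_left[symmetric] divide_inverse power_inverse mult.commute)
    finally show ?thesis using 2 c by (simp add: field_simps)
  qed
  then show ?thesis by (simp add: a_def c_def)
qed

end

section \<open>Codegrees of a nonnegative kernel and their products\<close>

lemma prod_Pow_insert:
  assumes "finite Q" "a \<notin> Q"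
  shows "(\<Prod>S\<in>Pow (insert a Q). h S) = (\<Prod>S\<in>Pow Q. h S * h (insert a S))"
proof -
  have "inj_on (insert a) (Pow Q)" using assms(2) by (auto simp: inj_on_def)
  moreover have "Pow Q \<inter> insert a ` Pow Q = {}" using assms(2) by auto
  ultimately show ?thesis
    using assms(1) by (simp add: Pow_insert prod.union_disjoint prod.reindex prod.distrib)
qed

text \<open>This abstracts the adjacency matrix of the host graph: the first argument of
  \<open>g\<close> is the image of a vertex in \<open>A\<close>, the second the image of a vertex in
  \<open>B\<close>.\<close>

locale nonneg_kernel =
  fixes V :: "'b set" and g :: "'b \<Rightarrow> 'b \<Rightarrow> real"
  assumes finite_V: "finite V" and V_nonempty: "V \<noteq> {}" and g_nonneg: "0 \<le> g u y"
begin

definition codegree :: "'a set \<Rightarrow> ('a \<Rightarrow> 'b) \<Rightarrow> real" where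
  "codegree S x = (\<Sum>y\<in>V. \<Prod>i\<in>S. g (x i) y) / card V"

text \<open>For finite \<open>R\<close> and an adjacency kernel, the mean of this is the
  homomorphism density of the bipartite graph in which, for every \<open>S \<subseteq> R\<close>,
  exactly \<open>m (card S)\<close> vertices have neighbourhood \<open>S\<close>.\<close>

definition weight :: "(nat \<Rightarrow> nat) \<Rightarrow> 'a set \<Rightarrow> ('a \<Rightarrow> 'b) \<Rightarrow> real" where
  "weight m R x = (\<Prod>S\<in>Pow R. codegree S x ^ m (card S))"

lemma card_V_pos: "0 < card V"
  using finite_V V_nonempty by (simp add: card_gt_0_iff)

lemma codegree_nonneg: "0 \<le> codegree S x"
  by (simp add: codegree_def sum_nonneg prod_nonneg g_nonneg)

lemma codegree_empty [simp]: "codegree {} x = 1"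
  using card_V_pos by (simp add: codegree_def)

lemma codegree_upd: "c \<notin> S \<Longrightarrow> codegree S (x(c := u)) = codegree S x"
  unfolding codegree_def by (intro arg_cong2[where f = "(/)"] sum.cong prod.cong) auto

lemma codegree_image: "inj \<pi> \<Longrightarrow> codegree (\<pi> ` S) x = codegree S (x \<circ> \<pi>)"
  by (simp add: codegree_def prod.reindex inj_on_subset)

lemma codegree_insert:
  "finite S \<Longrightarrow> a \<notin> S \<Longrightarrow>
    codegree (insert a S) x = (\<Sum>y\<in>V. g (x a) y * (\<Prod>i\<in>S. g (x i) y)) / card V"
  by (simp add: codegree_def)

lemma weight_nonneg: "0 \<le> weight m R x"
  by (simp add: weight_def prod_nonneg codegree_nonneg)

lemma weight_upd: "c \<notin> R \<Longrightarrow> weight m R (x(c := u)) = weight m R x"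
  unfolding weight_def by (intro prod.cong refl arg_cong2[where f = power] codegree_upd) auto

lemma weight_image:
  assumes "inj \<pi>"
  shows "weight m (\<pi> ` R) x = weight m R (x \<circ> \<pi>)"
proof -
  have "Pow (\<pi> ` R) = (`) \<pi> ` Pow R" by (rule image_Pow_surj[OF refl, symmetric])
  moreover have "inj_on ((`) \<pi>) (Pow R)" using assms by (auto simp: inj_on_def inj_image_eq_iff)
  ultimately show ?thesis
    unfolding weight_def
    by (simp add: prod.reindex codegree_image assms card_image inj_on_subset[OF assms])
qed

text \<open>Group the subsets of \<open>R\<close> by their part \<open>S\<close> outside
  \<open>{i, j}\<close>. Adding only \<open>i\<close> or only \<open>j\<close> gives sets of equal
  size, hence equal exponents, and a rank-one kernel built from \<phi>. Adding both gives \<theta>,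
  an average of rank-one kernels over the common neighbour; adding neither gives a constant.\<close>

lemma weight_gram:
  assumes "i \<in> R" "j \<in> R" "i \<noteq> j"
  shows "gram (\<lambda>u v. weight m R (x(i := u, j := v)))"
proof (cases "finite R")
  \<comment> \<open>\<open>Pow R\<close> is infinite, and a product over an infinite set is 1 by
    convention.\<close>
  case False
  then show ?thesis by (simp add: weight_def gram_const)
next
  case True
  define Q where "Q = R - {i, j}"
  have Q: "finite Q" "i \<notin> Q" "j \<notin> Q" "i \<notin> insert j Q" and R: "R = insert i (insert j Q)"
    using True assms by (auto simp: Q_def)
  define \<phi> where "\<phi> S u = (\<Sum>y\<in>V. g u y * (\<Prod>k\<in>S. g (x k) y)) / card V" for S u
  define \<theta> where "\<theta> S u v = (\<Sum>y\<in>V. g u y * g v y * (\<Prod>k\<in>S. g (x k) y)) / card V" for S u v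
  have eq: "weight m R (x(i := u, j := v)) = (\<Prod>S\<in>Pow Q. codegree S x ^ m (card S) *
      (\<phi> S u ^ m (Suc (card S)) * \<phi> S v ^ m (Suc (card S))) * \<theta> S u v ^ m (Suc (Suc (card S))))"
    (is "?L = ?R") for u v
  proof -
    let ?x = "x(i := u, j := v)"
    have *: "codegree S ?x = codegree S x" "codegree (insert i S) ?x = \<phi> S u"
      "codegree (insert j S) ?x = \<phi> S v" "codegree (insert i (insert j S)) ?x = \<theta> S u v"
      "card (insert i S) = Suc (card S)" "card (insert j S) = Suc (card S)"
      "card (insert i (insert j S)) = Suc (Suc (card S))" if "S \<in> Pow Q" for S
    proof -
      have S: "finite S" "i \<notin> S" "j \<notin> S" using that Q by (auto intro: finite_subset)
      have pr: "(\<Prod>k\<in>S. g (?x k) y) = (\<Prod>k\<in>S. g (x k) y)" for y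
        using S by (intro prod.cong) auto
      have ij: "finite (insert j S)" "i \<notin> insert j S" using S assms(3) by simp_all
      show "codegree S ?x = codegree S x" using S by (simp add: codegree_upd)
      show "codegree (insert i S) ?x = \<phi> S u" "codegree (insert j S) ?x = \<phi> S v"
        "codegree (insert i (insert j S)) ?x = \<theta> S u v"
        unfolding codegree_insert[OF S(1,2)] codegree_insert[OF S(1,3)] codegree_insert[OF ij]
          prod.insert[OF S(1,3)] pr \<phi>_def \<theta>_def
        using assms(3) by (simp_all add: mult.assoc)
      show "card (insert i S) = Suc (card S)" "card (insert j S) = Suc (card S)"
      "card (insert i (insert j S)) = Suc (Suc (card S))" using S assms(3) by simp_all
    qed
    have "?L = (\<Prod>S\<in>Pow Q. codegree S ?x ^ m (card S) * codegree (insert j S) ?x ^ m (card (insert j S))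
      * (codegree (insert i S) ?x ^ m (card (insert i S))
      * codegree (insert i (insert j S)) ?x ^ m (card (insert i (insert j S)))))"
      unfolding weight_def R using Q
      by (subst prod_Pow_insert, simp, simp, subst prod_Pow_insert) (simp_all only: prod.distrib simp_thms mult_ac)
    also have "\<dots> = ?R" by (intro prod.cong refl) (simp only: * mult_ac)
    finally show ?thesis .
  qed
  have "gram (\<theta> S)" for S
  proof -
    have "gram (\<lambda>u v. \<Sum>y\<in>V. (g u y * g v y) * ((\<Prod>k\<in>S. g (x k) y) / card V))"
      by (intro gram_sum gram_mult gram_rank_one gram_const) (simp add: prod_nonneg g_nonneg)
    then show ?thesis by (simp add: \<theta>_def[abs_def] sum_divide_distrib)
  qed
  then show ?thesis
    unfolding eq
    by (intro gram_prod gram_mult gram_rank_one gram_const gram_power) (simp_all add: codegree_nonneg)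
qed

lemma exchangeable_weight: "finite A \<Longrightarrow> exchangeable_weight A V (weight m)"
  by unfold_locales
    (simp_all add: finite_V weight_nonneg weight_upd weight_image weight_gram)

end

subsection \<open>A weight with a complete vertex\<close>

context nonneg_kernel
begin

definition mean_degree :: "'b \<Rightarrow> real" where
  "mean_degree y = (\<Sum>u\<in>V. g u y) / card V"

definition density :: real where
  "density = (\<Sum>y\<in>V. mean_degree y) / card V"

text \<open>The probability of centre \<open>y\<close> and leaves \<open>x\<close> in the random
  star: the centre has probability \<open>mean_degree y / (density * card V)\<close>, and each leaf,
  given the centre, \<open>g (x i) y / (mean_degree y * card V)\<close>. A centre of degree 0 gets
  the value 0.\<close>

definition star :: "'a set \<Rightarrow> ('a \<Rightarrow> 'b) \<Rightarrow> 'b \<Rightarrow> real" where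
  "star R x y = mean_degree y * (\<Prod>i\<in>R. g (x i) y / mean_degree y) / (density * card V ^ Suc (card R))"

lemma mean_degree_nonneg: "0 \<le> mean_degree y"
  by (simp add: mean_degree_def sum_nonneg g_nonneg)

lemma density_nonneg: "0 \<le> density"
  by (simp add: density_def sum_nonneg mean_degree_nonneg)

lemma star_nonneg: "0 \<le> star R x y"
  by (simp add: star_def mean_degree_nonneg density_nonneg g_nonneg prod_nonneg)

text \<open>On the support of the star the centre is a common neighbour of the leaves and
  contributes a positive term to each codegree. The logarithms taken later are thus of positive
  numbers wherever they count.\<close>

lemma star_pos:
  assumes "star R x y \<noteq> 0" "finite R" "y \<in> V" "S \<subseteq> R"
  shows "0 < star R x y" "0 < mean_degree y" "0 < codegree S x"
proof -
  show "0 < star R x y" using assms(1) star_nonneg[of R x y] by linarith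
  show "0 < mean_degree y"
  proof -
    have "mean_degree y \<noteq> 0" using assms(1) by (intro notI) (simp add: star_def)
    then show ?thesis using mean_degree_nonneg[of y] by linarith
  qed
  have g_pos: "0 < g (x i) y" if "i \<in> R" for i
  proof -
    have "g (x i) y \<noteq> 0"
    proof
      assume "g (x i) y = 0"
      then have "(\<Prod>i\<in>R. g (x i) y / mean_degree y) = 0"
        using that assms(2) by (intro prod_zero) (auto intro: bexI[of _ i])
      then show False using assms(1) by (simp add: star_def)
    qed
    then show ?thesis using g_nonneg[of "x i" y] by linarith
  qed
  have "0 < (\<Prod>i\<in>S. g (x i) y)"
    using assms(4) by (intro prod_pos g_pos) blast
  then have "0 < (\<Sum>y\<in>V. \<Prod>i\<in>S. g (x i) y)"
    using assms(3) finite_V by (intro sum_pos2[of V y]) (auto intro: prod_nonneg g_nonneg)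
  then show "0 < codegree S x" using card_V_pos by (simp add: codegree_def)
qed

text \<open>Given the centre, the leaves are independent and each has total probability 1, so the
  leaves outside \<open>S\<close> sum out.\<close>

lemma star_marginal:
  assumes "finite R" "S \<subseteq> R" and \<psi>: "\<And>x c w. c \<notin> S \<Longrightarrow> \<psi> (x(c := w)) = \<psi> x"
  shows "(\<Sum>x\<in>R \<rightarrow>\<^sub>E V. star R x y * \<psi> x) = (\<Sum>x\<in>S \<rightarrow>\<^sub>E V. star S x y * \<psi> x)"
proof (cases "mean_degree y = 0")
  case True
  then show ?thesis by (simp add: star_def)
next
  case False
  let ?d = "mean_degree y"
  define \<psi>' where "\<psi>' x = (\<Prod>i\<in>S. g (x i) y / ?d) * \<psi> x" for x
  have fin: "finite S" "finite (R - S)" using assms(1,2) by (auto intro: finite_subset)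
  have "(\<Sum>v\<in>V. g v y) = ?d * card V"
    using card_V_pos by (simp add: mean_degree_def)
  then have coordinate: "(\<Sum>v\<in>V. g v y / ?d) = card V"
    using False by (simp add: sum_divide_distrib[symmetric])
  have R: "R = S \<union> (R - S)" using assms(2) by blast
  have prod_R: "(\<Prod>i\<in>R. g (x i) y / ?d) = (\<Prod>i\<in>S. g (x i) y / ?d) * (\<Prod>i\<in>R - S. g (x i) y / ?d)" for x
    by (subst R, subst prod.union_disjoint) (use fin in auto)
  have "(\<Sum>x\<in>R \<rightarrow>\<^sub>E V. \<psi>' x * (\<Prod>i\<in>R - S. g (x i) y / ?d)) =
      (\<Sum>x\<in>S \<union> (R - S) \<rightarrow>\<^sub>E V. \<psi>' x * (\<Prod>i\<in>R - S. g (x i) y / ?d))"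
    using R by simp
  also have "\<dots> = (\<Sum>x\<in>S \<rightarrow>\<^sub>E V. \<psi>' x * (\<Prod>i\<in>R - S. \<Sum>v\<in>V. g v y / ?d))"
  proof (rule sum_PiE_Un[OF fin(2)])
    show "\<psi>' (x(c := w)) = \<psi>' x" if "c \<notin> S" for x c w
    proof -
      have "(\<Prod>i\<in>S. g ((x(c := w)) i) y / ?d) = (\<Prod>i\<in>S. g (x i) y / ?d)"
        using that by (intro prod.cong) auto
      then show ?thesis by (simp only: \<psi>'_def \<psi>[OF that])
    qed
  qed auto
  also have "\<dots> = (\<Sum>x\<in>S \<rightarrow>\<^sub>E V. \<psi>' x) * card V ^ card (R - S)"
    by (simp add: coordinate sum_distrib_right)
  finally have *: "(\<Sum>x\<in>R \<rightarrow>\<^sub>E V. \<psi>' x * (\<Prod>i\<in>R - S. g (x i) y / ?d)) = \<dots>" .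
  have "card R = card S + card (R - S)"
    using assms(1,2) card_mono[OF assms(1,2)] by (simp add: card_Diff_subset finite_subset)
  define q where "q = real (card V) ^ card (R - S)"
  have "q > 0" using card_V_pos by (simp add: q_def)
  have N: "real (card V) ^ Suc (card R) = real (card V) ^ Suc (card S) * q"
    unfolding \<open>card R = card S + card (R - S)\<close> by (simp add: power_add q_def)
  have "(\<Sum>x\<in>R \<rightarrow>\<^sub>E V. star R x y * \<psi> x) =
      ?d / (density * real (card V) ^ Suc (card R)) * (\<Sum>x\<in>R \<rightarrow>\<^sub>E V. \<psi>' x * (\<Prod>i\<in>R - S. g (x i) y / ?d))"
    unfolding sum_distrib_left star_def prod_R \<psi>'_def by (intro sum.cong refl) simp
  also have "\<dots> = ?d / (density * real (card V) ^ Suc (card S)) * (\<Sum>x\<in>S \<rightarrow>\<^sub>E V. \<psi>' x)"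
    unfolding * N of_nat_power q_def[symmetric] using \<open>q > 0\<close> by simp
  also have "\<dots> = (\<Sum>x\<in>S \<rightarrow>\<^sub>E V. star S x y * \<psi> x)"
    unfolding sum_distrib_left star_def \<psi>'_def by (intro sum.cong refl) simp
  finally show ?thesis .
qed

lemma sum_star:
  assumes "finite R"
  shows "(\<Sum>x\<in>R \<rightarrow>\<^sub>E V. star R x y) = mean_degree y / (density * card V)"
  using star_marginal[OF assms, of "{}" "\<lambda>_. 1" y] by (simp add: star_def)

text \<open>The power of \<open>mean_degree y\<close> cancels the denominators of the star and
  leaves the products that make up the codegree. It is an inequality because \<open>x\<close> may
  take values outside \<open>V\<close>: where \<open>mean_degree y = 0\<close>, only nonnegativity
  of the right-hand term is clear.\<close>

lemma sum_star_degree: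
  assumes "finite R" "S \<noteq> {}" "S \<subseteq> R" "density > 0"
  shows "(\<Sum>y\<in>V. star S x y * mean_degree y ^ (card S - 1)) \<le> codegree S x / (density * card V ^ card S)"
proof -
  have "finite S" using assms finite_subset by blast
  then obtain k where k: "card S = Suc k" using assms(2) by (metis card_0_eq not0_implies_Suc)
  have "star S x y * mean_degree y ^ (card S - 1) \<le> (\<Prod>i\<in>S. g (x i) y) / (density * card V ^ Suc (card S))" for y
  proof (cases "mean_degree y = 0")
    case True
    then show ?thesis by (simp add: star_def density_nonneg prod_nonneg g_nonneg)
  next
    case False
    have "mean_degree y * (\<Prod>i\<in>S. g (x i) y / mean_degree y) * mean_degree y ^ k = (\<Prod>i\<in>S. g (x i) y)"
      using False by (simp add: prod_dividef k)
    then show ?thesis unfolding star_def k by simp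
  qed
  then have "(\<Sum>y\<in>V. star S x y * mean_degree y ^ (card S - 1)) \<le>
      (\<Sum>y\<in>V. (\<Prod>i\<in>S. g (x i) y) / (density * card V ^ Suc (card S)))"
    by (rule sum_mono)
  also have "\<dots> = codegree S x / (density * card V ^ card S)"
    by (simp add: codegree_def sum_divide_distrib[symmetric] mult_ac)
  finally show ?thesis .
qed

text \<open>The tangent bound for the logarithm, which serves as Jensen's inequality for the
  star.\<close>

lemma star_mult_ln_le:
  assumes "star R x y \<noteq> 0 \<Longrightarrow> 0 < t"
  shows "star R x y * ln t \<le> star R x y * t - star R x y"
  using assms mult_left_mono[OF ln_le_minus_one star_nonneg, of t R x y]
  by (cases "star R x y = 0") (auto simp: algebra_simps)

section \<open>Mean logarithms under the random star\<close>

context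
  fixes R :: "'a set"
  assumes finite_R: "finite R" and density_pos: "0 < density"
begin

definition star_mean :: "(('a \<Rightarrow> 'b) \<Rightarrow> 'b \<Rightarrow> real) \<Rightarrow> real" where
  "star_mean F = (\<Sum>y\<in>V. \<Sum>x\<in>R \<rightarrow>\<^sub>E V. star R x y * F x y)"

lemma star_mean_const: "star_mean (\<lambda>x y. c) = c"
proof -
  have "(\<Sum>y\<in>V. mean_degree y / (density * card V)) = 1"
    unfolding sum_divide_distrib[symmetric] using density_pos card_V_pos
    by (simp add: density_def field_simps)
  then show ?thesis
    unfolding star_mean_def sum_distrib_right[symmetric] sum_star[OF finite_R] by simp
qed

text \<open>Choosing the centre proportionally to its degree favours large degrees: the difference
  of the two sides is the relative entropy of this choice against the uniform one. The tangent bound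
  at \<open>density / mean_degree y\<close> shows that it is nonnegative.\<close>

lemma star_mean_ln_degree: "ln density \<le> star_mean (\<lambda>x y. ln (mean_degree y))"
proof -
  have "mean_degree y * (ln density - ln (mean_degree y)) \<le> density - mean_degree y" for y
  proof (cases "mean_degree y = 0")
    case False
    then have pos: "mean_degree y > 0" using mean_degree_nonneg[of y] by simp
    have "ln density - ln (mean_degree y) \<le> density / mean_degree y - 1"
      using ln_le_minus_one[of "density / mean_degree y"] pos density_pos by (simp add: ln_div)
    then show ?thesis using mult_left_mono[OF _ less_imp_le[OF pos]] pos
      by (fastforce simp: field_simps)
  qed (use density_pos in simp)
  then have "(\<Sum>y\<in>V. mean_degree y * (ln density - ln (mean_degree y))) \<le> (\<Sum>y\<in>V. density - mean_degree y)"
    by (rule sum_mono)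
  also have "\<dots> = 0" using card_V_pos by (simp add: sum_subtractf density_def)
  finally have "(\<Sum>y\<in>V. mean_degree y * (ln density - ln (mean_degree y))) / (density * card V) \<le> 0"
    using density_pos card_V_pos by (simp add: divide_le_0_iff)
  also have "(\<Sum>y\<in>V. mean_degree y * (ln density - ln (mean_degree y))) / (density * card V) =
      star_mean (\<lambda>x y. ln density - ln (mean_degree y))"
    by (simp add: star_mean_def sum_distrib_right[symmetric] sum_star finite_R sum_divide_distrib)
  also have "\<dots> = ln density - star_mean (\<lambda>x y. ln (mean_degree y))"
    using star_mean_const[of "ln density"] by (simp add: star_mean_def right_diff_distrib sum_subtractf)
  finally show ?thesis by simp
qed

text \<open>By \<open>sum_star_degree\<close> the star mean of \<open>t\<close> is at most 1, so its
  mean logarithm is at most 0. This bounds the mean of \<open>ln (codegree S x)\<close> below by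
  \<open>ln density\<close> plus \<open>card S - 1\<close> times the mean of
  \<open>ln (mean_degree y)\<close>. The empty set is treated apart because of the truncated
  subtraction.\<close>

lemma star_mean_ln_codegree:
  assumes "S \<subseteq> R"
  shows "card S * ln density \<le> star_mean (\<lambda>x y. ln (codegree S x))"
proof (cases "S = {}")
  case True
  then show ?thesis by (simp add: star_mean_def)
next
  case False
  have fS: "finite S" using assms finite_R finite_subset by blast
  let ?k = "card S - 1"
  define t where "t x y = density * mean_degree y ^ ?k / codegree S x" for x y
  have "star_mean (\<lambda>x y. ln (t x y)) \<le> star_mean t - 1"
  proof -
    have "star_mean (\<lambda>x y. ln (t x y)) \<le> (\<Sum>y\<in>V. \<Sum>x\<in>R \<rightarrow>\<^sub>E V. star R x y * t x y - star R x y)"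
      unfolding star_mean_def using density_pos star_pos[OF _ finite_R] assms
      by (intro sum_mono star_mult_ln_le) (auto simp: t_def)
    then show ?thesis using star_mean_const[of 1] by (simp add: star_mean_def sum_subtractf)
  qed
  also have "star_mean t = (\<Sum>y\<in>V. \<Sum>x\<in>S \<rightarrow>\<^sub>E V. star S x y * t x y)"
    unfolding star_mean_def t_def
    by (intro sum.cong refl star_marginal finite_R assms) (simp add: codegree_upd)
  also have "\<dots> = (\<Sum>x\<in>S \<rightarrow>\<^sub>E V. density / codegree S x * (\<Sum>y\<in>V. star S x y * mean_degree y ^ ?k))"
    by (subst sum.swap) (simp add: t_def sum_distrib_left mult_ac)
  also have "\<dots> \<le> (\<Sum>x\<in>S \<rightarrow>\<^sub>E V. density / codegree S x * (codegree S x / (density * card V ^ card S)))"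
    using density_pos
    by (intro sum_mono mult_left_mono sum_star_degree[OF finite_R False assms])
      (auto intro!: divide_nonneg_nonneg codegree_nonneg)
  \<comment> \<open>Terms agree except where \<open>codegree S x = 0\<close>; there division by zero
    makes the left one 0.\<close>
  also have "\<dots> \<le> (\<Sum>x\<in>S \<rightarrow>\<^sub>E V. 1 / card V ^ card S)"
    using density_pos card_V_pos by (intro sum_mono) auto
  also have "\<dots> = 1" using card_V_pos fS by (simp add: card_funcsetE)
  finally have "star_mean (\<lambda>x y. ln (t x y)) \<le> 0" by simp
  also have "star_mean (\<lambda>x y. ln (t x y)) =
    star_mean (\<lambda>x y. ln density + ?k * ln (mean_degree y) - ln (codegree S x))"
    unfolding star_mean_def
  proof (intro sum.cong refl)
    fix x y assume y: "y \<in> V"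
    show "star R x y * ln (t x y) = star R x y * (ln density + ?k * ln (mean_degree y) - ln (codegree S x))"
    proof (cases "star R x y = 0")
      case False
      then show ?thesis using star_pos[OF False finite_R y assms] density_pos
        by (simp add: t_def ln_div ln_mult ln_realpow)
    qed simp
  qed
  also have "\<dots> = ln density + ?k * star_mean (\<lambda>x y. ln (mean_degree y)) - star_mean (\<lambda>x y. ln (codegree S x))"
    using star_mean_const[of "ln density"]
    by (simp add: star_mean_def algebra_simps sum_subtractf sum.distrib sum_distrib_left)
  finally have "ln density + ?k * star_mean (\<lambda>x y. ln (mean_degree y)) \<le> star_mean (\<lambda>x y. ln (codegree S x))"
    by simp
  moreover have "?k * ln density \<le> ?k * star_mean (\<lambda>x y. ln (mean_degree y))"
    by (intro mult_left_mono star_mean_ln_degree) simp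
  moreover have "card S = Suc ?k" using fS False by (simp add: card_gt_0_iff)
  then have "card S * ln density = ln density + ?k * ln density"
    by (metis (no_types) add.commute mult.commute mult_1 of_nat_Suc ring_class.ring_distribs(2))
  ultimately show ?thesis by linarith
qed

text \<open>One factor \<open>codegree R\<close> is set aside, which
  \<open>1 \<le> m (card R)\<close> permits; it cancels the codegree that
  \<open>sum_star_degree\<close> produces when the star mean of \<open>t\<close> is turned into a
  uniform mean. The other factors are bounded through their mean logarithms.\<close>

lemma mean_weight_ge:
  assumes "R \<noteq> {}" "1 \<le> m (card R)"
  shows "density ^ (\<Sum>S\<in>Pow R. card S * m (card S)) \<le> (\<Sum>x\<in>R \<rightarrow>\<^sub>E V. weight m R x) / card V ^ card R"
proof -
  let ?r = "card R"
  define e where "e = (\<Sum>S\<in>Pow R. card S * m (card S))"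
  have r: "1 \<le> ?r" using assms(1) finite_R by (simp add: Suc_le_eq card_gt_0_iff)
  have e_split: "e = (\<Sum>S\<in>Pow R - {R}. card S * m (card S)) + ?r * m ?r"
    unfolding e_def using finite_R by (subst sum.remove[of _ R]) auto
  then have "?r \<le> e" using assms(2) by (simp add: trans_le_add2)
  then have e: "1 \<le> e" using r by simp
  \<comment> \<open>The exponents that remain after one copy of \<open>codegree R\<close> is
    removed; their nonnegativity lets the lower bounds for the mean logarithms be added up with
    these coefficients.\<close>
  define c where "c S = real (m (card S)) - (if S = R then 1 else 0)" for S
  have c: "0 \<le> c S" for S using assms(2) by (simp add: c_def)
  have sum_c: "(\<Sum>S\<in>Pow R. c S * f S) = (\<Sum>S\<in>Pow R. m (card S) * f S) - f R" for f :: "'a set \<Rightarrow> real"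
  proof -
    have "(\<Sum>S\<in>Pow R. c S * f S) = (\<Sum>S\<in>Pow R. m (card S) * f S - (if S = R then f S else 0))"
      by (intro sum.cong refl) (simp add: c_def left_diff_distrib)
    then show ?thesis using finite_R by (simp add: sum_subtractf)
  qed
  define t where "t x y = mean_degree y ^ (?r - 1) * (weight m R x / codegree R x) / density ^ (e - 1)" for x y
  have ln_t: "star R x y * ln (t x y) = star R x y *
      ((?r - 1) * ln (mean_degree y) + (\<Sum>S\<in>Pow R. c S * ln (codegree S x)) - (e - 1) * ln density)"
    (is "_ = _ * ?rhs") and t_pos: "star R x y \<noteq> 0 \<Longrightarrow> 0 < t x y" if y: "y \<in> V" for x y
  proof -
    have "0 < t x y \<and> ln (t x y) = ?rhs" if nz: "star R x y \<noteq> 0"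
    proof
      note pos = star_pos[OF nz finite_R y]
      have w: "0 < weight m R x" unfolding weight_def using pos(3) by (intro prod_pos) auto
      show "0 < t x y" unfolding t_def using w pos(2,3)[of R] density_pos by simp
      have "ln (weight m R x) = (\<Sum>S\<in>Pow R. m (card S) * ln (codegree S x))"
        unfolding weight_def
      proof (subst ln_prod)
        show "codegree S x ^ m (card S) \<noteq> 0" if "S \<in> Pow R" for S
          using pos(3)[of S] that by force
      qed (simp_all add: finite_R ln_realpow)
      moreover have "(\<Sum>S\<in>Pow R. c S * ln (codegree S x)) =
          (\<Sum>S\<in>Pow R. m (card S) * ln (codegree S x)) - ln (codegree R x)"
        by (rule sum_c)
      ultimately show "ln (t x y) = ?rhs"
        unfolding t_def using w pos(2,3)[of R] density_pos by (simp add: ln_div ln_mult ln_realpow)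
    qed
    then show "star R x y * ln (t x y) = star R x y * ?rhs" "star R x y \<noteq> 0 \<Longrightarrow> 0 < t x y" by auto
  qed
  have "real (\<Sum>S\<in>Pow R. card S * m (card S)) - ?r = (\<Sum>S\<in>Pow R. c S * card S)"
    using sum_c[of "\<lambda>S. real (card S)"] by (simp add: mult.commute)
  then have "(real e - ?r) * ln density = (\<Sum>S\<in>Pow R. c S * (card S * ln density))"
    by (simp only: e_def sum_distrib_right mult.assoc)
  also have "\<dots> \<le> (\<Sum>S\<in>Pow R. c S * star_mean (\<lambda>x y. ln (codegree S x)))"
    by (intro sum_mono mult_left_mono star_mean_ln_codegree c) auto
  finally have 1: "(real e - ?r) * ln density \<le> (\<Sum>S\<in>Pow R. c S * star_mean (\<lambda>x y. ln (codegree S x)))" .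
  have 2: "(?r - 1) * ln density \<le> (?r - 1) * star_mean (\<lambda>x y. ln (mean_degree y))"
    by (intro mult_left_mono star_mean_ln_degree) simp
  have "star_mean (\<lambda>x y. ln (t x y)) = star_mean (\<lambda>x y.
      (?r - 1) * ln (mean_degree y) + (\<Sum>S\<in>Pow R. c S * ln (codegree S x)) - (e - 1) * ln density)"
    unfolding star_mean_def by (intro sum.cong refl ln_t)
  also have "\<dots> = (?r - 1) * star_mean (\<lambda>x y. ln (mean_degree y))
      + star_mean (\<lambda>x y. \<Sum>S\<in>Pow R. c S * ln (codegree S x)) - (e - 1) * ln density"
    using star_mean_const[of "(e - 1) * ln density"]
    by (simp add: star_mean_def right_diff_distrib distrib_left sum_subtractf sum.distrib sum_distrib_left mult_ac)
  also have "star_mean (\<lambda>x y. \<Sum>S\<in>Pow R. c S * ln (codegree S x)) =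
      (\<Sum>S\<in>Pow R. c S * star_mean (\<lambda>x y. ln (codegree S x)))"
    unfolding star_mean_def sum_distrib_left
    by (simp only: sum.swap[of _ "Pow R"] mult_ac)
  finally have "0 \<le> star_mean (\<lambda>x y. ln (t x y))"
    using 1 2 r e by (simp add: algebra_simps)
  also have "\<dots> \<le> (\<Sum>y\<in>V. \<Sum>x\<in>R \<rightarrow>\<^sub>E V. star R x y * t x y - star R x y)"
    unfolding star_mean_def by (intro sum_mono star_mult_ln_le t_pos)
  also have "\<dots> = star_mean t - 1"
    using star_mean_const[of 1] by (simp add: star_mean_def sum_subtractf)
  also have "star_mean t = (\<Sum>x\<in>R \<rightarrow>\<^sub>E V. weight m R x / codegree R x / density ^ (e - 1)
      * (\<Sum>y\<in>V. star R x y * mean_degree y ^ (?r - 1)))"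
    unfolding star_mean_def
    by (subst sum.swap) (simp add: t_def sum_distrib_left sum_divide_distrib mult_ac)
  also have "\<dots> \<le> (\<Sum>x\<in>R \<rightarrow>\<^sub>E V. weight m R x / codegree R x / density ^ (e - 1)
      * (codegree R x / (density * card V ^ ?r)))"
    using density_pos
    by (intro sum_mono mult_left_mono sum_star_degree[OF finite_R assms(1)])
      (auto intro!: divide_nonneg_nonneg mult_nonneg_nonneg codegree_nonneg weight_nonneg)
  also have "\<dots> \<le> (\<Sum>x\<in>R \<rightarrow>\<^sub>E V. weight m R x / (density ^ Suc (e - 1) * card V ^ ?r))"
    using density_pos card_V_pos
    by (intro sum_mono)
      (auto simp: mult_ac intro!: divide_nonneg_nonneg mult_nonneg_nonneg weight_nonneg)
  also have "\<dots> = (\<Sum>x\<in>R \<rightarrow>\<^sub>E V. weight m R x) / card V ^ ?r / density ^ e"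
    using e by (simp add: sum_divide_distrib mult_ac)
  finally have "1 \<le> (\<Sum>x\<in>R \<rightarrow>\<^sub>E V. weight m R x) / card V ^ ?r / density ^ e" by simp
  then show ?thesis
    unfolding e_def[symmetric] using density_pos by (subst (asm) le_divide_eq_1_pos) simp_all
qed

end
end

subsection \<open>Symmetrisation\<close>

lemma sum_Pow_card:
  fixes h :: "nat \<Rightarrow> 'c :: comm_semiring_1"
  assumes "finite R"
  shows "(\<Sum>S\<in>Pow R. h (card S)) = (\<Sum>k\<le>card R. of_nat (card R choose k) * h k)"
proof -
  have "(\<Sum>S\<in>Pow R. h (card S)) = (\<Sum>k\<le>card R. \<Sum>S\<in>{S \<in> Pow R. card S = k}. h (card S))"
    using assms by (subst sum.group) (auto simp: card_mono)
  also have "\<dots> = (\<Sum>k\<le>card R. of_nat (card R choose k) * h k)"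
    using n_subsets[OF assms] by (intro sum.cong refl) simp
  finally show ?thesis .
qed

lemma bij_betw_comp_permutes_PiE:
  assumes "\<pi> permutes A"
  shows "bij_betw (\<lambda>x. x \<circ> \<pi>) (A \<rightarrow>\<^sub>E V) (A \<rightarrow>\<^sub>E V)"
proof (rule bij_betw_byWitness[where f' = "\<lambda>x. x \<circ> inv \<pi>"])
  have *: "(\<lambda>x. x \<circ> \<sigma>) ` (A \<rightarrow>\<^sub>E V) \<subseteq> A \<rightarrow>\<^sub>E V" if "\<sigma> permutes A" for \<sigma>
    using that by (fastforce simp: PiE_iff extensional_def permutes_in_image permutes_not_in)
  show "(\<lambda>x. x \<circ> \<pi>) ` (A \<rightarrow>\<^sub>E V) \<subseteq> A \<rightarrow>\<^sub>E V"
    "(\<lambda>x. x \<circ> inv \<pi>) ` (A \<rightarrow>\<^sub>E V) \<subseteq> A \<rightarrow>\<^sub>E V"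
    using * assms permutes_inv by blast+
qed (use assms in \<open>simp_all add: comp_assoc permutes_inv_o\<close>)

lemma ex_permutes_image_eq:
  assumes "finite A" "S \<subseteq> A" "T \<subseteq> A" "card S = card T"
  shows "\<exists>\<pi>. \<pi> permutes A \<and> \<pi> ` S = T"
proof -
  have fin: "finite S" "finite T" using assms finite_subset by auto
  then obtain f where f: "bij_betw f S T" using assms(4) finite_same_card_bij by blast
  have "card (A - S) = card (A - T)" using assms fin by (simp add: card_Diff_subset)
  then obtain h where h: "bij_betw h (A - S) (A - T)"
    using assms(1) finite_same_card_bij[of "A - S" "A - T"] by auto
  define \<pi> where "\<pi> x = (if x \<in> S then f x else if x \<in> A then h x else x)" for x
  have 1: "bij_betw \<pi> S T" using f by (rule bij_betw_cong[THEN iffD1, rotated]) (simp add: \<pi>_def)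
  have 2: "bij_betw \<pi> (A - S) (A - T)"
    using h by (rule bij_betw_cong[THEN iffD1, rotated]) (simp add: \<pi>_def)
  have "bij_betw \<pi> (S \<union> (A - S)) (T \<union> (A - T))" using 1 2 by (rule bij_betw_combine) auto
  moreover have "S \<union> (A - S) = A" "T \<union> (A - T) = A" using assms by auto
  ultimately have "\<pi> permutes A" using assms(2) by (intro bij_imp_permutes) (auto simp: \<pi>_def)
  then show ?thesis using 1 by (auto simp: bij_betw_def)
qed

context nonneg_kernel
begin

text \<open>The pointwise bound \<open>gibbs\<close> is summed over all \<open>x\<close>, with
  \<open>W\<close> as an unnormalised density. Its left side sums to 0: the sum \<phi> depends only
  on the size of the set, and by \<open>m\<close> the neighbourhoods \<open>N b\<close> have each
  positive size as often as the sets \<open>S\<close>, counted over all \<open>R \<in> \<C>\<close>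
  with multiplicity \<open>m (card S)\<close>.\<close>

lemma sum_prod_weight_le:
  fixes A :: "'a set" and N :: "'c \<Rightarrow> 'a set" and r :: nat
  defines "\<C> \<equiv> {R. R \<subseteq> A \<and> card R = r}"
  assumes fin: "finite A" "finite B"
    and N: "\<And>b. b \<in> B \<Longrightarrow> N b \<subseteq> A" "\<And>b. b \<in> B \<Longrightarrow> card (N b) \<le> r"
    and m0: "m 0 = 0"
    and m: "\<And>k. 1 \<le> k \<Longrightarrow> k \<le> r \<Longrightarrow>
      card {b \<in> B. card (N b) = k} = (card A choose r) * (r choose k) * m k"
  shows "(\<Sum>x\<in>A \<rightarrow>\<^sub>E V. \<Prod>R\<in>\<C>. weight m R x) \<le> (\<Sum>x\<in>A \<rightarrow>\<^sub>E V. \<Prod>b\<in>B. codegree (N b) x)"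
proof -
  have finC: "finite \<C>" using fin by (simp add: \<C>_def)
  define W where "W x = (\<Prod>R\<in>\<C>. weight m R x)" for x
  define F where "F x = (\<Prod>b\<in>B. codegree (N b) x)" for x
  have W_nonneg: "0 \<le> W x" for x by (simp add: W_def prod_nonneg weight_nonneg)
  have F_nonneg: "0 \<le> F x" for x by (simp add: F_def prod_nonneg codegree_nonneg)
  define \<phi> where "\<phi> S = (\<Sum>x\<in>A \<rightarrow>\<^sub>E V. W x * ln (codegree S x))" for S
  have \<phi>_cong: "\<phi> S = \<phi> T" if "S \<subseteq> A" "T \<subseteq> A" "card S = card T" for S T
  proof -
    obtain \<pi> where \<pi>: "\<pi> permutes A" "\<pi> ` S = T"
      using ex_permutes_image_eq[OF fin(1) \<open>S \<subseteq> A\<close> \<open>T \<subseteq> A\<close> \<open>card S = card T\<close>] by blast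
    have inj: "inj \<pi>" using \<pi>(1) by (rule permutes_inj)
    have "bij_betw ((`) \<pi>) \<C> \<C>"
    proof (rule bij_betw_imageI)
      show inj': "inj_on ((`) \<pi>) \<C>" using inj by (simp add: inj_on_def inj_image_eq_iff)
      have "(`) \<pi> ` \<C> \<subseteq> \<C>"
        using permutes_image[OF \<pi>(1)] inj by (auto simp: \<C>_def card_image inj_on_subset)
      then show "(`) \<pi> ` \<C> = \<C>" using inj' finC by (simp add: endo_inj_surj)
    qed
    then have W_comp: "W (x \<circ> \<pi>) = W x" for x
      unfolding W_def weight_image[OF inj, symmetric] by (rule prod.reindex_bij_betw)
    have "\<phi> S = (\<Sum>x\<in>A \<rightarrow>\<^sub>E V. W (x \<circ> \<pi>) * ln (codegree S (x \<circ> \<pi>)))"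
      unfolding \<phi>_def
      by (rule sum.reindex_bij_betw[OF bij_betw_comp_permutes_PiE[OF \<pi>(1)], symmetric])
    also have "\<dots> = \<phi> T" by (simp add: \<phi>_def W_comp codegree_image[OF inj, symmetric] \<pi>(2))
    finally show ?thesis .
  qed
  \<comment> \<open>The common value of \<phi> on the \<open>k\<close>-subsets of \<open>A\<close>.
    For \<open>k > card A\<close> it is unspecified, and no \<open>N b\<close> has that
    size.\<close>
  define \<kappa> where "\<kappa> k = \<phi> (SOME S. S \<subseteq> A \<and> card S = k)" for k
  have \<phi>_eq: "\<phi> S = \<kappa> (card S)" if "S \<subseteq> A" for S
    unfolding \<kappa>_def using someI[of "\<lambda>T. T \<subseteq> A \<and> card T = card S" S] that by (intro \<phi>_cong) auto
  have \<kappa>0: "\<kappa> 0 = 0" using \<phi>_eq[of "{}"] by (simp add: \<phi>_def)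
  have gibbs: "W x * ((\<Sum>b\<in>B. ln (codegree (N b) x))
      - (\<Sum>R\<in>\<C>. \<Sum>S\<in>Pow R. m (card S) * ln (codegree S x))) \<le> F x - W x" for x
  proof (cases "W x = 0")
    case True
    then show ?thesis using F_nonneg by simp
  next
    case False
    have factor_nz: "codegree S x ^ m (card S) \<noteq> 0" if "R \<in> \<C>" "S \<in> Pow R" for R S
    proof
      assume "codegree S x ^ m (card S) = 0"
      moreover have "finite R" using that fin(1) by (auto simp: \<C>_def intro: finite_subset)
      ultimately have "weight m R x = 0" unfolding weight_def using that(2) by (intro prod_zero) auto
      then have "W x = 0" unfolding W_def using that(1) finC by (intro prod_zero) auto
      then show False using False by simp
    qed
    then have weight_nz: "weight m R x \<noteq> 0" if "R \<in> \<C>" for R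
      using that fin(1) finite_subset unfolding weight_def by (subst prod_zero_iff) (auto simp: \<C>_def)
    \<comment> \<open>The vertex \<open>b\<close> itself shows that \<open>m (card (N b))\<close> is
      nonzero and that \<open>r\<close>-sets exist. So \<open>codegree (N b) x\<close> occurs among
      the factors of \<open>W x\<close>, which is nonzero.\<close>
    have codegree_nz: "codegree (N b) x \<noteq> 0" if b: "b \<in> B" for b
    proof (cases "card (N b) = 0")
      case True
      then have "N b = {}" using finite_subset[OF N(1)[OF b] fin(1)] by simp
      then show ?thesis by simp
    next
      case k: False
      then have "card {c \<in> B. card (N c) = card (N b)} = (card A choose r) * (r choose card (N b)) * m (card (N b))"
        using N(2)[OF b] by (intro m) auto
      moreover have "card {c \<in> B. card (N c) = card (N b)} \<noteq> 0" using b fin(2) by auto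
      ultimately have "card A choose r \<noteq> 0" and m_pos: "m (card (N b)) \<noteq> 0" by auto
      then have "r \<le> card A" by (meson binomial_eq_0 not_le)
      then obtain R where "N b \<subseteq> R" "R \<subseteq> A" "card R = r"
        using exists_subset_between[OF N(2)[OF b] _ N(1)[OF b] fin(1)] by auto
      then show ?thesis using factor_nz[of R "N b"] m_pos by (auto simp: \<C>_def)
    qed
    have "ln (weight m R x) = (\<Sum>S\<in>Pow R. m (card S) * ln (codegree S x))" if "R \<in> \<C>" for R
      unfolding weight_def
    proof (subst ln_prod)
      show "finite (Pow R)" using that fin(1) by (auto simp: \<C>_def intro: finite_subset)
      show "codegree S x ^ m (card S) \<noteq> 0" if "S \<in> Pow R" for S
        using \<open>R \<in> \<C>\<close> that by (rule factor_nz)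
    qed (simp add: ln_realpow)
    then have "ln (W x) = (\<Sum>R\<in>\<C>. \<Sum>S\<in>Pow R. m (card S) * ln (codegree S x))"
      unfolding W_def using finC weight_nz by (subst ln_prod) auto
    moreover have "ln (F x) = (\<Sum>b\<in>B. ln (codegree (N b) x))"
      unfolding F_def using fin(2) codegree_nz by (intro ln_prod) auto
    moreover have pos: "W x > 0" using False W_nonneg[of x] by simp
    moreover have "F x \<noteq> 0" unfolding F_def using fin(2) codegree_nz by simp
    then have "F x > 0" using F_nonneg[of x] by simp
    ultimately have "(\<Sum>b\<in>B. ln (codegree (N b) x)) - (\<Sum>R\<in>\<C>. \<Sum>S\<in>Pow R. m (card S) * ln (codegree S x))
        \<le> F x / W x - 1"
      using ln_le_minus_one[of "F x / W x"] by (simp add: ln_div)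
    then have "W x * ((\<Sum>b\<in>B. ln (codegree (N b) x)) - (\<Sum>R\<in>\<C>. \<Sum>S\<in>Pow R. m (card S) * ln (codegree S x)))
        \<le> W x * (F x / W x - 1)"
      using pos by (intro mult_left_mono) auto
    also have "\<dots> = F x - W x" using pos by (simp add: right_diff_distrib)
    finally show ?thesis .
  qed
  have "(\<Sum>b\<in>B. \<phi> (N b)) = (\<Sum>R\<in>\<C>. \<Sum>S\<in>Pow R. m (card S) * \<phi> S)"
  proof -
    have "(\<Sum>b\<in>B. \<phi> (N b)) = (\<Sum>b\<in>B. \<kappa> (card (N b)))"
      using N(1) by (intro sum.cong refl \<phi>_eq)
    also have "\<dots> = (\<Sum>k\<le>r. \<Sum>b\<in>{b \<in> B. card (N b) = k}. \<kappa> (card (N b)))"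
      using fin(2) N(2) by (subst sum.group) auto
    also have "\<dots> = (\<Sum>k\<le>r. card {b \<in> B. card (N b) = k} * \<kappa> k)"
      by (intro sum.cong refl) simp
    also have "\<dots> = (\<Sum>k\<le>r. card \<C> * (real (r choose k) * (m k * \<kappa> k)))"
    proof (intro sum.cong refl)
      \<comment> \<open>The hypothesis \<open>m\<close> does not cover \<open>k = 0\<close>; there
        both sides vanish because \<open>\<kappa> 0 = 0\<close>.\<close>
      fix k assume "k \<in> {..r}"
      then show "card {b \<in> B. card (N b) = k} * \<kappa> k = card \<C> * (real (r choose k) * (m k * \<kappa> k))"
        using m[of k] \<kappa>0 n_subsets[OF fin(1), of r] by (cases "k = 0") (auto simp: \<C>_def)
    qed
    also have "\<dots> = (\<Sum>R\<in>\<C>. \<Sum>k\<le>r. real (r choose k) * (m k * \<kappa> k))"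
      by (simp add: sum_distrib_left)
    also have "\<dots> = (\<Sum>R\<in>\<C>. \<Sum>S\<in>Pow R. m (card S) * \<phi> S)"
    proof (intro sum.cong refl)
      fix R assume "R \<in> \<C>"
      then have R: "finite R" "card R = r" "R \<subseteq> A" using fin(1) by (auto simp: \<C>_def intro: finite_subset)
      have "(\<Sum>S\<in>Pow R. m (card S) * \<phi> S) = (\<Sum>S\<in>Pow R. m (card S) * \<kappa> (card S))"
        using R(3) by (intro sum.cong refl) (simp add: \<phi>_eq)
      also have "\<dots> = (\<Sum>k\<le>r. real (r choose k) * (m k * \<kappa> k))"
        using sum_Pow_card[OF R(1), of "\<lambda>k. m k * \<kappa> k"] R(2) by simp
      finally show "(\<Sum>k\<le>r. real (r choose k) * (m k * \<kappa> k)) = (\<Sum>S\<in>Pow R. m (card S) * \<phi> S)" ..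
    qed
    finally show ?thesis .
  qed
  then have "0 = (\<Sum>x\<in>A \<rightarrow>\<^sub>E V. W x * ((\<Sum>b\<in>B. ln (codegree (N b) x))
      - (\<Sum>R\<in>\<C>. \<Sum>S\<in>Pow R. m (card S) * ln (codegree S x))))"
    by (simp add: \<phi>_def right_diff_distrib sum_subtractf sum_distrib_left sum.swap[of _ B] sum.swap[of _ \<C>]
        sum.swap[of _ "Pow _"] mult.left_commute)
  also have "\<dots> \<le> (\<Sum>x\<in>A \<rightarrow>\<^sub>E V. F x - W x)" by (intro sum_mono gibbs)
  finally show ?thesis by (simp add: sum_subtractf F_def W_def)
qed

end

subsection \<open>Homomorphism densities of bipartite graphs\<close>

context nonneg_kernel
begin

lemma mean_weight_superset:
  assumes "finite A" "R \<subseteq> A"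
  shows "(\<Sum>x\<in>A \<rightarrow>\<^sub>E V. weight m R x) / card V ^ card A = (\<Sum>x\<in>R \<rightarrow>\<^sub>E V. weight m R x) / card V ^ card R"
proof -
  have fin: "finite R" "finite (A - R)" using assms finite_subset by auto
  have "(\<Sum>x\<in>R \<union> (A - R) \<rightarrow>\<^sub>E V. weight m R x * (\<Prod>b\<in>A - R. 1)) =
      (\<Sum>x\<in>R \<rightarrow>\<^sub>E V. weight m R x * (\<Prod>b\<in>A - R. \<Sum>v\<in>V. 1))"
    by (rule sum_PiE_Un) (use fin weight_upd in auto)
  then have "(\<Sum>x\<in>A \<rightarrow>\<^sub>E V. weight m R x) = (\<Sum>x\<in>R \<rightarrow>\<^sub>E V. weight m R x) * real (card V) ^ card (A - R)"
    by (simp add: Un_absorb1[OF assms(2)] sum_distrib_right)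
  moreover have "card A = card R + card (A - R)"
    using assms fin card_mono[OF assms] by (simp add: card_Diff_subset)
  then have "real (card V) ^ card A = real (card V) ^ card R * real (card V) ^ card (A - R)"
    by (simp add: power_add)
  ultimately show ?thesis using card_V_pos by simp
qed

end

section \<open>Neighbourhoods in a bipartite graph and the codegree formula for its homomorphism
  density\<close>

definition nbrs :: "'a ugraph \<Rightarrow> 'a set \<Rightarrow> 'a \<Rightarrow> 'a set" where
  "nbrs H A b = {a \<in> A. {a, b} \<in> edges H}"

lemma
  assumes "simple_graph H" "bipartition H A B"
  shows finite_parts: "finite A" "finite B"
    and card_verts_bipartition: "card (verts H) = card A + card B"
  using assms by (auto simp: simple_graph_def bipartition_def card_Un_disjoint dest: sym)

lemma
  assumes "simple_graph H" "bipartition H A B"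
  shows degree_eq_card_nbrs: "b \<in> B \<Longrightarrow> degree H b = card (nbrs H A b)"
    and card_edges_eq_sum_nbrs: "card (edges H) = (\<Sum>b\<in>B. card (nbrs H A b))"
proof -
  note fin = finite_parts[OF assms]
  have disj: "A \<inter> B = {}" and ends: "\<And>e. e \<in> edges H \<Longrightarrow> \<exists>a\<in>A. \<exists>b\<in>B. e = {a, b}"
    using assms(2) by (auto simp: bipartition_def)
  have star: "{e \<in> edges H. b \<in> e} = (\<lambda>a. {a, b}) ` nbrs H A b" if b: "b \<in> B" for b
  proof
    show "{e \<in> edges H. b \<in> e} \<subseteq> (\<lambda>a. {a, b}) ` nbrs H A b"
    proof
      fix e assume e: "e \<in> {e \<in> edges H. b \<in> e}"
      then obtain a b' where "a \<in> A" "b' \<in> B" "e = {a, b'}" using ends by blast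
      moreover from this have "b' = b" using e b disj by auto
      ultimately show "e \<in> (\<lambda>a. {a, b}) ` nbrs H A b" using e by (auto simp: nbrs_def)
    qed
  qed (auto simp: nbrs_def)
  have inj: "inj_on (\<lambda>a. {a, b}) (nbrs H A b)" for b
    by (auto simp: inj_on_def doubleton_eq_iff)
  show deg: "degree H b = card (nbrs H A b)" if "b \<in> B" for b
    by (simp add: degree_def star[OF that] card_image[OF inj])
  have "edges H = (\<Union>b\<in>B. {e \<in> edges H. b \<in> e})" using ends by blast
  also have "card \<dots> = (\<Sum>b\<in>B. card {e \<in> edges H. b \<in> e})"
  proof (rule card_UN_disjoint)
    show "\<forall>b\<in>B. finite {e \<in> edges H. b \<in> e}"
      using star fin(1) by (simp add: nbrs_def)
    show "\<forall>b\<in>B. \<forall>c\<in>B. b \<noteq> c \<longrightarrow> {e \<in> edges H. b \<in> e} \<inter> {e \<in> edges H. c \<in> e} = {}"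
      using ends disj by blast
  qed (rule fin(2))
  also have "\<dots> = (\<Sum>b\<in>B. card (nbrs H A b))"
    by (intro sum.cong refl) (simp add: degree_def[symmetric] deg)
  finally show "card (edges H) = (\<Sum>b\<in>B. card (nbrs H A b))" .
qed

lemma prod_of_bool: "finite A \<Longrightarrow> (\<Prod>a\<in>A. of_bool (P a)) = (of_bool (\<forall>a\<in>A. P a) :: real)"
  by (induction A rule: finite_induct) auto

locale host_graph =
  fixes G :: "'b ugraph"
  assumes simple_G: "simple_graph G" and verts_G: "verts G \<noteq> {}"
begin

sublocale nonneg_kernel "verts G" "\<lambda>u v. of_bool ({u, v} \<in> edges G)"
  using simple_G verts_G by unfold_locales (simp_all add: simple_graph_def)

text \<open>A map is a homomorphism exactly when each \<open>b\<close> goes to a common neighbour of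
  the images of its neighbourhood. Given the images of \<open>A\<close>, these choices are
  independent, so \<open>sum_PiE_Un\<close> applies.\<close>

lemma hom_density_bipartite:
  assumes "simple_graph H" "bipartition H A B"
  shows "hom_density H G = (\<Sum>x\<in>A \<rightarrow>\<^sub>E verts G. \<Prod>b\<in>B. codegree (nbrs H A b) x) / card (verts G) ^ card A"
proof -
  let ?V = "verts G"
  note fin = finite_parts[OF assms]
  have disj: "A \<inter> B = {}" and V: "verts H = A \<union> B"
    and ends: "\<And>e. e \<in> edges H \<Longrightarrow> \<exists>a\<in>A. \<exists>b\<in>B. e = {a, b}"
    using assms(2) by (auto simp: bipartition_def)
  have fin_nbrs: "finite (nbrs H A b)" for b using fin(1) by (simp add: nbrs_def)
  have hom_iff: "(\<forall>e\<in>edges H. f ` e \<in> edges G) \<longleftrightarrow> (\<forall>b\<in>B. \<forall>a\<in>nbrs H A b. {f a, f b} \<in> edges G)" for f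
  proof
    assume hom: "\<forall>b\<in>B. \<forall>a\<in>nbrs H A b. {f a, f b} \<in> edges G"
    show "\<forall>e\<in>edges H. f ` e \<in> edges G"
    proof
      fix e assume "e \<in> edges H"
      moreover from this obtain a b where "a \<in> A" "b \<in> B" "e = {a, b}" using ends by blast
      ultimately show "f ` e \<in> edges G" using hom by (simp add: nbrs_def)
    qed
  qed (force simp: nbrs_def)
  have "finite (A \<union> B \<rightarrow>\<^sub>E ?V)" using fin finite_V by (intro finite_PiE) auto
  then have "real (hom_count H G) = (\<Sum>f\<in>A \<union> B \<rightarrow>\<^sub>E ?V. of_bool (\<forall>e\<in>edges H. f ` e \<in> edges G))"
    by (simp add: hom_count_def homs_def V of_bool_def sum.If_cases Int_def)
  also have "\<dots> = (\<Sum>f\<in>A \<union> B \<rightarrow>\<^sub>E ?V. 1 * (\<Prod>b\<in>B. \<Prod>a\<in>nbrs H A b. of_bool ({f a, f b} \<in> edges G)))"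
    unfolding hom_iff using fin fin_nbrs by (simp add: prod_of_bool)
  also have "\<dots> = (\<Sum>x\<in>A \<rightarrow>\<^sub>E ?V. 1 * (\<Prod>b\<in>B. \<Sum>v\<in>?V. \<Prod>a\<in>nbrs H A b. of_bool ({x a, v} \<in> edges G)))"
  proof (rule sum_PiE_Un[OF fin(2) disj])
    show "(\<Prod>a\<in>nbrs H A b. of_bool ({(f(c := w)) a, v} \<in> edges G)) =
        (\<Prod>a\<in>nbrs H A b. of_bool ({f a, v} \<in> edges G))" if "c \<notin> A" for b f c w v
      using that by (intro prod.cong) (auto simp: nbrs_def)
  qed simp
  also have "\<dots> = (\<Sum>x\<in>A \<rightarrow>\<^sub>E ?V. \<Prod>b\<in>B. card ?V * codegree (nbrs H A b) x)"
    using card_V_pos by (simp add: codegree_def)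
  also have "\<dots> = card ?V ^ card B * (\<Sum>x\<in>A \<rightarrow>\<^sub>E ?V. \<Prod>b\<in>B. codegree (nbrs H A b) x)"
    by (simp add: prod.distrib sum_distrib_left)
  finally show ?thesis
    using card_V_pos by (simp add: hom_density_def card_verts_bipartition[OF assms] power_add)
qed

lemma hom_density_K2: "hom_density K2 G = density"
proof -
  have "simple_graph K2" "bipartition K2 {False} {True}"
    by (auto simp: simple_graph_def bipartition_def K2_def)
  moreover have "nbrs K2 {False} True = {False}" by (auto simp: nbrs_def K2_def)
  ultimately have "hom_density K2 G = (\<Sum>x\<in>{False} \<rightarrow>\<^sub>E verts G. codegree {False} x) / card (verts G)"
    by (simp add: hom_density_bipartite)
  also have "\<dots> = density"
    by (simp add: sum_PiE_insert codegree_def density_def mean_degree_def sum_divide_distrib[symmetric])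
      (rule disjI2, rule sum.swap)
  finally show ?thesis .
qed

end

theorem theorem1p1:
  fixes H :: "'a ugraph" and A B :: "'a set" and r :: nat and G :: "'b ugraph"
  assumes "simple_graph H"
    and "bipartition H A B"
    and "r = Max (degree H ` B)"
    and "\<And>k. 1 \<le> k \<Longrightarrow> k \<le> r \<Longrightarrow>
           (card A choose r) * (r choose k) dvd card {b \<in> B. degree H b = k}"
    and "simple_graph G" and "verts G \<noteq> {}"
  shows "hom_density H G \<ge> hom_density K2 G ^ card (edges H)"
proof -
  interpret host_graph G using assms by unfold_locales
  note fin = finite_parts[OF assms(1,2)]
  let ?V = "verts G" and ?N = "nbrs H A" and ?n = "card A"
  have e: "card (edges H) = (\<Sum>b\<in>B. card (?N b))" by (rule card_edges_eq_sum_nbrs[OF assms(1,2)])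
  \<comment> \<open>An edge guarantees that \<open>B\<close> is nonempty, so that \<open>Max\<close>
    is attained, and that \<open>r\<close> is positive; positive density is needed for
    logarithms.\<close>
  consider "card (edges H) = 0" | "card (edges H) > 0" "density = 0" | "card (edges H) > 0" "density > 0"
    using density_nonneg by fastforce
  then show ?thesis
  proof cases
    case 1
    then have "?N b = {}" if "b \<in> B" for b
      using e that fin by (simp add: nbrs_def)
    then have "hom_density H G = (\<Sum>x\<in>A \<rightarrow>\<^sub>E ?V. 1) / card ?V ^ card A"
      by (simp add: hom_density_bipartite[OF assms(1,2)])
    then have "hom_density H G = 1" using fin(1) card_V_pos by (simp add: card_funcsetE)
    then show ?thesis using 1 by simp
  next
    case 2
    have "0 \<le> hom_density H G" by (simp add: hom_density_def)
    then show ?thesis using 2 by (simp add: hom_density_K2 zero_power)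
  next
    case 3
    have deg: "degree H b = card (?N b)" if "b \<in> B" for b
      using that by (rule degree_eq_card_nbrs[OF assms(1,2)])
    have dB: "{b \<in> B. degree H b = k} = {b \<in> B. card (?N b) = k}" for k using deg by auto
    have N_sub: "?N b \<subseteq> A" for b by (auto simp: nbrs_def)
    obtain b1 where b1: "b1 \<in> B" "card (?N b1) > 0"
      using 3(1) e by (metis gr0I sum.neutral less_numeral_extra(3))
    have N_le: "card (?N b) \<le> r" if "b \<in> B" for b
      using that fin(2) deg assms(3) by (metis Max_ge finite_imageI imageI)
    have "r \<in> degree H ` B" unfolding assms(3) using b1 fin(2) by (intro Max_in) auto
    then obtain b0 where b0: "b0 \<in> B" "card (?N b0) = r" using deg by auto
    have r: "1 \<le> r" using N_le[OF b1(1)] b1(2) by simp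
    have rn: "r \<le> ?n" using b0 card_mono[OF fin(1) N_sub] by metis
    \<comment> \<open>Isolated vertices of \<open>B\<close> get exponent 0: the divisibility
      hypothesis starts at \<open>k = 1\<close>, and their codegree is 1.\<close>
    define m where "m k = (if k = 0 then 0
      else card {b \<in> B. card (?N b) = k} div ((?n choose r) * (r choose k)))" for k
    have m: "card {b \<in> B. card (?N b) = k} = (?n choose r) * (r choose k) * m k" if "1 \<le> k" "k \<le> r" for k
      using assms(4)[OF that] that unfolding m_def dB by simp
    have "card {b \<in> B. card (?N b) = r} > 0" using b0 fin(2) by (auto simp: card_gt_0_iff)
    \<comment> \<open>The maximum degree is attained at \<open>b0\<close>, so the count for
      \<open>k = r\<close> is a nonzero multiple. This supplies the complete vertex for
      \<open>mean_weight_ge\<close>.\<close>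
    then have mr: "1 \<le> m r" using m[OF r] by (cases "m r") auto
    obtain R where R: "R \<subseteq> A" "card R = r" using rn obtain_subset_with_card_n by metis
    have finR: "finite R" using R(1) fin(1) finite_subset by auto
    define \<C> where "\<C> = {R. R \<subseteq> A \<and> card R = r}"
    interpret exchangeable_weight A ?V "weight m" by (rule exchangeable_weight[OF fin(1)])
    \<comment> \<open>Counting edges by the degree of their end in \<open>B\<close> shows that each
      of the \<open>card \<C>\<close> weights accounts for an equal share of them, so the exponent
      factorises.\<close>
    have "(\<Sum>b\<in>B. card (?N b)) = (\<Sum>k\<le>r. \<Sum>b\<in>{b \<in> B. card (?N b) = k}. card (?N b))"
      using fin(2) N_le by (subst sum.group) auto
    also have "\<dots> = (\<Sum>k\<le>r. (?n choose r) * ((r choose k) * (k * m k)))"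
    proof (intro sum.cong refl)
      fix k assume "k \<in> {..r}"
      then show "(\<Sum>b\<in>{b \<in> B. card (?N b) = k}. card (?N b)) = (?n choose r) * ((r choose k) * (k * m k))"
        using m[of k] by (cases "k = 0") (auto simp: mult_ac)
    qed
    also have "\<dots> = (?n choose r) * (\<Sum>S\<in>Pow R. card S * m (card S))"
      using sum_Pow_card[OF finR, of "\<lambda>k. k * m k"] R(2) by (simp add: sum_distrib_left)
    also have "?n choose r = card \<C>" using n_subsets[OF fin(1)] by (simp add: \<C>_def)
    finally have e': "card (edges H) = (\<Sum>S\<in>Pow R. card S * m (card S)) * card \<C>" using e by simp
    have "hom_density K2 G ^ card (edges H) = (density ^ (\<Sum>S\<in>Pow R. card S * m (card S))) ^ card \<C>"
      by (simp add: hom_density_K2 e' power_mult)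
    also have "\<dots> \<le> ((\<Sum>x\<in>R \<rightarrow>\<^sub>E ?V. weight m R x) / card ?V ^ card R) ^ card \<C>"
      using r R(2) mr finR 3(2) by (intro power_mono mean_weight_ge) auto
    also have "\<dots> = ((\<Sum>x\<in>A \<rightarrow>\<^sub>E ?V. weight m R x) / card ?V ^ card A) ^ card \<C>"
      using mean_weight_superset[OF fin(1) R(1), of m] by simp
    also have "\<dots> \<le> (\<Sum>x\<in>A \<rightarrow>\<^sub>E ?V. \<Prod>R\<in>\<C>. weight m R x) / card ?V ^ card A"
      unfolding \<C>_def by (rule mean_power_le) (use R verts_G in auto)
    also have "\<dots> \<le> (\<Sum>x\<in>A \<rightarrow>\<^sub>E ?V. \<Prod>b\<in>B. codegree (?N b) x) / card ?V ^ card A"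
      unfolding \<C>_def
      by (intro divide_right_mono sum_prod_weight_le fin N_sub N_le m) (auto simp: m_def)
    also have "\<dots> = hom_density H G" by (rule hom_density_bipartite[OF assms(1,2), symmetric])
    finally show ?thesis .
  qed
qed

end
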